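(* Let $(A,p_l)$ be a weakly amenable Fréchet algebra. Then for each $n\in\mathbb{N}$, the Fréchet algebra $A^{\#}$ is $(2n+1)$-weakly amenable if and only if $A$ is $(2n+1)$-weakly amenable.
   Context: All spaces are complex and $\mathbb{N}=\{1,2,\dots\}$. A Fréchet algebra $(A,p_l)$ is an algebra that is complete and Hausdorff for the topology generated by a separating, increasing sequence $(p_l)_{l\in\mathbb{N}}$ of submultiplicative seminorms. The unitization of $A$ is $A^{\#}=A\oplus\mathbb{C}e$ with product $(a,\lambda)(b,\mu)=(ab+\mu a+\lambda b,\lambda\mu)$ and seminorms $q_l(a,\lambda)=p_l(a)+|\lambda|$; it is a Fréchet algebra with identity $e=(0,1)$. For a locally convex space $X$, $X^*$ is its continuous dual with the strong topology (uniform convergence on bounded subsets of $X$); $X^{(0)}=X$ and $X^{(n)}=(X^{(n-1)})^*$. If $B$ is a Fréchet algebra and $X$ a locally convex $B$-bimodule, then $X^*$ is a $B$-bimodule via $\langle b\cdot f,x\rangle=\langle f,x\cdot b\rangle$ and $\langle f\cdot b,x\rangle=\langle f,b\cdot x\rangle$; iterating, every $X^{(n)}$ is a $B$-bimodule. $B$ is a bimodule over itself by multiplication. A continuous derivation $D:B\to X$ is a continuous linear map with $D(ab)=a\cdot D(b)+D(a)\cdot b$ for all $a,b\in B$; it is inner if there is $x\in X$ with $D(b)=b\cdot x-x\cdot b$ for all $b\in B$. $B$ is $n$-weakly amenable if every continuous derivation $B\to B^{(n)}$ is inner; weakly amenable means $1$-weakly amenable. *)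

theory Defs
  imports "HOL-Analysis.Analysis" "HOL-Library.Function_Algebras"
begin

section \<open>Complex vector spaces and complex algebras\<close>

class complex_vector = ab_group_add +
  fixes scaleC :: "complex \<Rightarrow> 'a \<Rightarrow> 'a" (infixr "*\<^sub>C" 75)
  assumes scaleC_add_right: "a *\<^sub>C (x + y) = a *\<^sub>C x + a *\<^sub>C y"
    and scaleC_add_left: "(a + b) *\<^sub>C x = a *\<^sub>C x + b *\<^sub>C x"
    and scaleC_scaleC: "a *\<^sub>C b *\<^sub>C x = (a * b) *\<^sub>C x"
    and scaleC_one: "1 *\<^sub>C x = x"

global_interpretation complex_vector: vector_space "scaleC :: complex \<Rightarrow> 'a \<Rightarrow> 'a::complex_vector"
  by unfold_locales
    (rule scaleC_add_right scaleC_add_left scaleC_scaleC scaleC_one)+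

text \<open>Algebras are associative but need not have an identity (class \<^class>\<open>ring\<close>).\<close>

class complex_algebra = complex_vector + ring +
  assumes scaleC_mult_left: "(a *\<^sub>C x) * y = a *\<^sub>C (x * y)"
    and scaleC_mult_right: "x * (a *\<^sub>C y) = a *\<^sub>C (x * y)"

instantiation complex :: complex_vector
begin
definition "a *\<^sub>C (x::complex) = a * x"
instance by standard (simp_all add: scaleC_complex_def algebra_simps)
end

instantiation prod :: (complex_vector, complex_vector) complex_vector
begin
definition "a *\<^sub>C x = (a *\<^sub>C fst x, a *\<^sub>C snd x)"
instance
  by standard (simp_all add: scaleC_prod_def scaleC_add_right scaleC_add_left
      scaleC_scaleC scaleC_one)
end

instantiation "fun" :: (type, complex_vector) complex_vector
begin
definition "a *\<^sub>C f = (\<lambda>x. a *\<^sub>C f x)"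
instance
  by standard (simp_all add: scaleC_fun_def fun_eq_iff scaleC_add_right scaleC_add_left
      scaleC_scaleC scaleC_one)
end

section \<open>Locally convex spaces and Frechet algebras\<close>

definition seminorm :: "('a::complex_vector \<Rightarrow> real) \<Rightarrow> bool" where
  "seminorm p \<longleftrightarrow>
     (\<forall>x y. p (x + y) \<le> p x + p y) \<and> (\<forall>a x. p (a *\<^sub>C x) = cmod a * p x)"

text \<open>The topology on \<open>S\<close> generated by a set \<open>P\<close> of seminorms.\<close>

definition seminorm_topology ::
  "'x::complex_vector set \<Rightarrow> ('x \<Rightarrow> real) set \<Rightarrow> 'x topology" where
  "seminorm_topology S P = topology_generated_by
     (insert S {{y \<in> S. p (y - x) < e} | x p e. x \<in> S \<and> p \<in> P \<and> 0 < e})"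

text \<open>The index set of the sequence of seminorms is \<open>{0, 1, 2, ...}\<close>. Since the sequence is
  countable, completeness may be expressed by sequences.\<close>

definition frechet_algebra :: "(nat \<Rightarrow> 'a::complex_algebra \<Rightarrow> real) \<Rightarrow> bool" where
  "frechet_algebra p \<longleftrightarrow>
     (\<forall>l. seminorm (p l)) \<and>
     (\<forall>l x y. p l (x * y) \<le> p l x * p l y) \<and>
     (\<forall>l x. p l x \<le> p (Suc l) x) \<and>
     (\<forall>x. (\<forall>l. p l x = 0) \<longrightarrow> x = 0) \<and>
     (\<forall>s :: nat \<Rightarrow> 'a.
        (\<forall>l. \<forall>e>0. \<exists>N. \<forall>m\<ge>N. \<forall>n\<ge>N. p l (s m - s n) < e) \<longrightarrow>
        (\<exists>x. limitin (seminorm_topology UNIV (range p)) s x sequentially))"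

section \<open>Unitization\<close>

datatype 'a unitization = Unitization (alg_part: 'a) (scalar_part: complex)

instantiation unitization :: (complex_algebra) complex_algebra
begin
definition "0 = Unitization 0 0"
definition "x + y = Unitization (alg_part x + alg_part y) (scalar_part x + scalar_part y)"
definition "- x = Unitization (- alg_part x) (- scalar_part x)"
definition "x - y = Unitization (alg_part x - alg_part y) (scalar_part x - scalar_part y)"
definition "a *\<^sub>C x = Unitization (a *\<^sub>C alg_part x) (a * scalar_part x)"
definition "x * y = Unitization
  (alg_part x * alg_part y + scalar_part y *\<^sub>C alg_part x + scalar_part x *\<^sub>C alg_part y)
  (scalar_part x * scalar_part y)"
instance
  by standard
    (simp_all add: zero_unitization_def plus_unitization_def uminus_unitization_def
      minus_unitization_def scaleC_unitization_def times_unitization_def algebra_simps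
      scaleC_add_right scaleC_add_left scaleC_scaleC scaleC_one
      scaleC_mult_left scaleC_mult_right)
end

definition unitization_seminorms ::
  "(nat \<Rightarrow> 'a \<Rightarrow> real) \<Rightarrow> nat \<Rightarrow> 'a unitization \<Rightarrow> real" where
  "unitization_seminorms p l x = p l (alg_part x) + cmod (scalar_part x)"

section \<open>Bimodules and their duals\<close>

text \<open>A locally convex bimodule over \<open>'b\<close>: its carrier is a linear subspace of the type \<open>'x\<close>,
  its topology is generated by a set of seminorms. Seminorms and actions are only relevant on
  the carrier.\<close>

record ('b, 'x) bimodule =
  carrier :: "'x set"
  seminorms :: "('x \<Rightarrow> real) set"
  lact :: "'b \<Rightarrow> 'x \<Rightarrow> 'x"
  ract :: "'x \<Rightarrow> 'b \<Rightarrow> 'x"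

definition bimodule_topology :: "('b, 'x::complex_vector) bimodule \<Rightarrow> 'x topology" where
  "bimodule_topology M = seminorm_topology (carrier M) (seminorms M)"

definition bounded_subset :: "('b, 'x) bimodule \<Rightarrow> 'x set \<Rightarrow> bool" where
  "bounded_subset M B \<longleftrightarrow> B \<subseteq> carrier M \<and> (\<forall>p\<in>seminorms M. bdd_above (p ` B))"

text \<open>Functionals on the carrier are extended by \<open>0\<close>, so that distinct elements of the dual are
  distinct functions on \<open>'x\<close>.\<close>

definition continuous_functionals ::
  "('b, 'x::complex_vector) bimodule \<Rightarrow> ('x \<Rightarrow> complex) set" where
  "continuous_functionals M = {f.
     (\<forall>x\<in>carrier M. \<forall>y\<in>carrier M. f (x + y) = f x + f y) \<and>
     (\<forall>a. \<forall>x\<in>carrier M. f (a *\<^sub>C x) = a * f x) \<and>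
     continuous_map (bimodule_topology M) euclidean f \<and>
     (\<forall>x. x \<notin> carrier M \<longrightarrow> f x = 0)}"

text \<open>The continuous dual with the strong topology.\<close>

definition dual_bimodule ::
  "('b, 'x::complex_vector) bimodule \<Rightarrow> ('b, 'x \<Rightarrow> complex) bimodule" where
  "dual_bimodule M = \<lparr>
     carrier = continuous_functionals M,
     seminorms = {\<lambda>f. SUP x\<in>B. cmod (f x) | B. bounded_subset M B \<and> B \<noteq> {}},
     lact = \<lambda>b f x. if x \<in> carrier M then f (ract M x b) else 0,
     ract = \<lambda>f b x. if x \<in> carrier M then f (lact M b x) else 0\<rparr>"

definition self_bimodule ::
  "(nat \<Rightarrow> 'a::complex_algebra \<Rightarrow> real) \<Rightarrow> ('a, 'a) bimodule" where
  "self_bimodule p = \<lparr>carrier = UNIV, seminorms = range p, lact = (*), ract = (*)\<rparr>"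

text \<open>Transport of structure along a map \<open>h\<close> that is linear and injective on the carrier.\<close>

definition transport :: "('x \<Rightarrow> 'y) \<Rightarrow> ('b, 'x) bimodule \<Rightarrow> ('b, 'y) bimodule" where
  "transport h M = (let g = inv_into (carrier M) h in \<lparr>
     carrier = h ` carrier M,
     seminorms = {\<lambda>y. p (g y) | p. p \<in> seminorms M},
     lact = \<lambda>b y. h (lact M b (g y)),
     ract = \<lambda>y b. h (ract M (g y) b)\<rparr>)"

section \<open>Iterated duals\<close>

text \<open>The \<open>n\<close>-th dual of a space over \<open>'x\<close> naturally lives in the \<open>n\<close>-fold iterated function
  type over \<open>'x\<close>, which cannot depend on a variable \<open>n\<close>. The spaces \<open>X, X*, X**, ...\<close>
  are therefore realized as linear subspaces of one type \<open>'u\<close>: \<open>i\<close> embeds \<open>'x\<close> into \<open>'u\<close>, and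
  \<open>c k\<close> embeds the functions on level \<open>k\<close> (extended by \<open>0\<close>) into \<open>'u\<close>, their image being level
  \<open>k + 1\<close>. The condition \<open>dual_universe i c n\<close> says that \<open>'u\<close> is large enough for \<open>n\<close> iterations.
  It involves no topology, and by the two existence lemmas below every \<open>n\<close> admits such
  a type: start from \<open>'x\<close> and pass \<open>n\<close> times from \<open>'u\<close> to \<open>'u \<times> ('u \<Rightarrow> complex)\<close>.\<close>

primrec dual_level ::
  "('x \<Rightarrow> 'u) \<Rightarrow> (nat \<Rightarrow> ('u \<Rightarrow> complex) \<Rightarrow> 'u) \<Rightarrow> nat \<Rightarrow> 'u set" where
  "dual_level i c 0 = range i"
| "dual_level i c (Suc k) = c k ` {f. \<forall>u. u \<notin> dual_level i c k \<longrightarrow> f u = 0}"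

definition dual_universe ::
  "('x::complex_vector \<Rightarrow> 'u::complex_vector) \<Rightarrow> (nat \<Rightarrow> ('u \<Rightarrow> complex) \<Rightarrow> 'u) \<Rightarrow> nat \<Rightarrow> bool"
  where
  "dual_universe i c n \<longleftrightarrow>
     Vector_Spaces.linear scaleC scaleC i \<and> inj i \<and>
     (\<forall>k<n. Vector_Spaces.linear scaleC scaleC (c k) \<and>
            inj_on (c k) {f. \<forall>u. u \<notin> dual_level i c k \<longrightarrow> f u = 0})"

primrec iterated_dual ::
  "('x \<Rightarrow> 'u::complex_vector) \<Rightarrow> (nat \<Rightarrow> ('u \<Rightarrow> complex) \<Rightarrow> 'u) \<Rightarrow>
   ('b, 'x) bimodule \<Rightarrow> nat \<Rightarrow> ('b, 'u) bimodule" where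
  "iterated_dual i c M 0 = transport i M"
| "iterated_dual i c M (Suc k) = transport (c k) (dual_bimodule (iterated_dual i c M k))"

lemma carrier_iterated_dual_subset: "carrier (iterated_dual i c M k) \<subseteq> dual_level i c k"
proof (induction k)
  case 0
  show ?case by (auto simp: transport_def Let_def)
next
  case (Suc k)
  then have "carrier (dual_bimodule (iterated_dual i c M k))
      \<subseteq> {f. \<forall>u. u \<notin> dual_level i c k \<longrightarrow> f u = 0}"
    by (auto simp: dual_bimodule_def continuous_functionals_def)
  then show ?case
    by (simp add: transport_def Let_def image_mono)
qed

lemma inj_on_carrier_dual:
  assumes "dual_universe i c n" "k < n"
  shows "inj_on (c k) (carrier (dual_bimodule (iterated_dual i c M k)))"
proof (rule inj_on_subset)
  show "inj_on (c k) {f. \<forall>u. u \<notin> dual_level i c k \<longrightarrow> f u = 0}"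
    using assms by (simp add: dual_universe_def)
  show "carrier (dual_bimodule (iterated_dual i c M k))
      \<subseteq> {f. \<forall>u. u \<notin> dual_level i c k \<longrightarrow> f u = 0}"
    using carrier_iterated_dual_subset[of i c M k]
    by (auto simp: dual_bimodule_def continuous_functionals_def)
qed

lemma dual_universe_0: "dual_universe (\<lambda>x::'x::complex_vector. x) c 0"
  by (simp add: dual_universe_def complex_vector.linear_ident)

lemma dual_universe_Suc:
  fixes i :: "'x::complex_vector \<Rightarrow> 'u::complex_vector"
  assumes "dual_universe i c n"
  shows "\<exists>(i' :: 'x \<Rightarrow> 'u \<times> ('u \<Rightarrow> complex)) c'. dual_universe i' c' (Suc n)"
proof -
  define e :: "'u \<Rightarrow> 'u \<times> ('u \<Rightarrow> complex)" where "e = (\<lambda>u. (u, 0))"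
  define i' where "i' = e \<circ> i"
  define c' where "c' = (\<lambda>k f. if k < n then e (c k (f \<circ> e)) else (0, f \<circ> e))"
  define supp where "supp = (\<lambda>L. {f :: 'u \<Rightarrow> complex. \<forall>u. u \<notin> L \<longrightarrow> f u = 0})"
  define supp' where
    "supp' = (\<lambda>L. {f :: 'u \<times> ('u \<Rightarrow> complex) \<Rightarrow> complex. \<forall>w. w \<notin> L \<longrightarrow> f w = 0})"
  have inj_e: "inj e"
    by (auto simp: e_def inj_def)
  have add_e: "e (u + v) = e u + e v" for u v
    by (simp add: e_def)
  have scale_e: "e (r *\<^sub>C u) = r *\<^sub>C e u" for r u
    by (simp add: e_def scaleC_prod_def complex_vector.scale_zero_right)
  have restr: "bij_betw (\<lambda>f. f \<circ> e) (supp' (e ` L)) (supp L)" for L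
  proof (rule bij_betwI[where g = "\<lambda>g w. if w \<in> e ` L then g (inv e w) else 0"])
    show "(\<lambda>f. f \<circ> e) \<in> supp' (e ` L) \<rightarrow> supp L"
      by (simp add: Pi_iff supp_def supp'_def inj_image_mem_iff[OF inj_e] del: split_paired_All)
    show "(\<lambda>g w. if w \<in> e ` L then g (inv e w) else 0) \<in> supp L \<rightarrow> supp' (e ` L)"
      by (simp add: Pi_iff supp'_def del: split_paired_All)
  next
    fix f assume "f \<in> supp' (e ` L)"
    then show "(\<lambda>w. if w \<in> e ` L then (f \<circ> e) (inv e w) else 0) = f"
      using inj_e by (intro ext) (auto simp: supp'_def simp del: split_paired_All)
  next
    fix g assume "g \<in> supp L"
    then show "(\<lambda>w. if w \<in> e ` L then g (inv e w) else 0) \<circ> e = g"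
      by (intro ext) (simp add: supp_def inj_image_mem_iff[OF inj_e] inv_f_f[OF inj_e])
  qed
  have c: "Vector_Spaces.linear scaleC scaleC (c k)" "inj_on (c k) (supp (dual_level i c k))"
    if "k < n" for k
    using assms that by (simp_all add: dual_universe_def supp_def)
  have level: "dual_level i' c' k = e ` dual_level i c k" if "k \<le> n" for k
    using that
  proof (induction k)
    case 0
    show ?case by (simp add: i'_def image_comp)
  next
    case (Suc k)
    then have "dual_level i' c' (Suc k) = c' k ` supp' (e ` dual_level i c k)"
      by (simp add: supp'_def)
    also have "\<dots> = e ` c k ` (\<lambda>f. f \<circ> e) ` supp' (e ` dual_level i c k)"
      using Suc.prems by (simp add: c'_def image_comp comp_def)
    also have "\<dots> = e ` dual_level i c (Suc k)"
      using bij_betw_imp_surj_on[OF restr[of "dual_level i c k"]] by (simp add: supp_def)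
    finally show ?case .
  qed
  have "Vector_Spaces.linear scaleC scaleC (c' k) \<and> inj_on (c' k) (supp' (dual_level i' c' k))"
    if "k < Suc n" for k
  proof
    have lev: "dual_level i' c' k = e ` dual_level i c k"
      using that by (intro level) simp
    have add: "(f + g) \<circ> e = (f \<circ> e) + (g \<circ> e)" for f g :: "'u \<times> ('u \<Rightarrow> complex) \<Rightarrow> complex"
      by (simp add: fun_eq_iff)
    have scale: "(r *\<^sub>C f) \<circ> e = r *\<^sub>C (f \<circ> e)"
      for r and f :: "'u \<times> ('u \<Rightarrow> complex) \<Rightarrow> complex"
      by (simp add: fun_eq_iff scaleC_fun_def)
    show "Vector_Spaces.linear scaleC scaleC (c' k)"
    proof (cases "k < n")
      case True
      interpret c: Vector_Spaces.linear scaleC scaleC "c k"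
        using True by (rule c)
      show ?thesis
        using True by unfold_locales (simp_all add: c'_def add scale add_e scale_e c.add c.scale)
    next
      case False
      then show ?thesis
        by unfold_locales
          (simp_all add: c'_def add scale scaleC_prod_def complex_vector.scale_zero_right)
    qed
    show "inj_on (c' k) (supp' (dual_level i' c' k))"
    proof (rule inj_onI)
      fix f g
      assume fg: "f \<in> supp' (dual_level i' c' k)" "g \<in> supp' (dual_level i' c' k)"
        and eq: "c' k f = c' k g"
      have "f \<circ> e = g \<circ> e"
      proof (cases "k < n")
        case True
        have "f \<circ> e \<in> supp (dual_level i c k)" "g \<circ> e \<in> supp (dual_level i c k)"
          using fg bij_betw_apply[OF restr] by (simp_all add: lev)
        moreover have "c k (f \<circ> e) = c k (g \<circ> e)"
          using eq True inj_e by (simp add: c'_def inj_eq)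
        ultimately show ?thesis
          using c(2)[OF True] by (simp add: inj_on_eq_iff)
      next
        case False
        then show ?thesis using eq by (simp add: c'_def)
      qed
      then show "f = g"
        using inj_onD[OF bij_betw_imp_inj_on[OF restr[of "dual_level i c k"]]] fg
        unfolding lev by blast
    qed
  qed
  moreover have "Vector_Spaces.linear scaleC scaleC i'"
  proof -
    interpret i: Vector_Spaces.linear scaleC scaleC i
      using assms by (simp add: dual_universe_def)
    show ?thesis
      by unfold_locales (simp_all add: i'_def i.add i.scale add_e scale_e)
  qed
  moreover have "inj i'"
    using assms inj_e by (simp add: dual_universe_def i'_def inj_compose)
  ultimately have "dual_universe i' c' (Suc n)"
    by (simp add: dual_universe_def supp'_def)
  then show ?thesis by blast
qed

section \<open>Derivations and weak amenability\<close>

definition continuous_derivation ::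
  "(nat \<Rightarrow> 'b::complex_algebra \<Rightarrow> real) \<Rightarrow> ('b, 'x::complex_vector) bimodule \<Rightarrow>
   ('b \<Rightarrow> 'x) \<Rightarrow> bool" where
  "continuous_derivation p M D \<longleftrightarrow>
     Vector_Spaces.linear scaleC scaleC D \<and>
     continuous_map (seminorm_topology UNIV (range p)) (bimodule_topology M) D \<and>
     (\<forall>a. D a \<in> carrier M) \<and>
     (\<forall>a b. D (a * b) = lact M a (D b) + ract M (D a) b)"

definition inner_derivation ::
  "('b, 'x::complex_vector) bimodule \<Rightarrow> ('b \<Rightarrow> 'x) \<Rightarrow> bool" where
  "inner_derivation M D \<longleftrightarrow> (\<exists>x\<in>carrier M. \<forall>b. D b = lact M b x - ract M x b)"

definition n_weakly_amenable ::
  "('b \<Rightarrow> 'u::complex_vector) \<Rightarrow> (nat \<Rightarrow> ('u \<Rightarrow> complex) \<Rightarrow> 'u) \<Rightarrow> nat \<Rightarrow>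
   (nat \<Rightarrow> 'b::complex_algebra \<Rightarrow> real) \<Rightarrow> bool" where
  "n_weakly_amenable i c n p \<longleftrightarrow>
     (\<forall>D. continuous_derivation p (iterated_dual i c (self_bimodule p) n) D \<longrightarrow>
          inner_derivation (iterated_dual i c (self_bimodule p) n) D)"

end

theory Submission
  imports Defs
begin

text \<open>For odd \<open>k\<close>, the \<open>k\<close>-th dual of \<open>A\<^sup>#\<close> splits topologically as the \<open>k\<close>-th dual of \<open>A\<close> plus \<open>\<complex>\<close>, with
  action \<open>a \<cdot> (f, \<mu>) = (a \<cdot> f, f(a))\<close> of \<open>a \<in> A\<close>, where \<open>f(a)\<close> is evaluation at the canonical image of
  \<open>a\<close> in the \<open>(k - 1)\<close>-st dual, and likewise on the right. Hence a derivation of \<open>A\<^sup>#\<close> into its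
  \<open>k\<close>-th dual is a pair \<open>(d, \<tau>)\<close> with \<open>d\<close> a derivation of \<open>A\<close> and \<open>\<tau>(ab) = d(b)(a) + d(a)(b)\<close>, and
  it is inner iff \<open>d\<close> is inner and \<open>\<tau> = 0\<close>. Weak amenability of \<open>A\<close> is used twice. If \<open>d\<close> is inner,
  then \<open>\<tau>\<close> vanishes on products, hence everywhere. Conversely, restricting the functionals \<open>d(a)\<close>
  to \<open>A\<close> gives a derivation into the first dual; it is inner, so \<open>d(a)(b) + d(b)(a) = 0\<close> and
  \<open>(d, 0)\<close> is a derivation of \<open>A\<^sup>#\<close>.\<close>

section \<open>Continuous linear maps between seminormed carriers\<close>

text \<open>The left and right actions of \<open>u\<close> change the
  \<open>\<sigma>\<close>-coordinate by the same amount, so \<open>\<sigma>\<close> vanishes on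
  every commutator \<open>u y - y u\<close>. This is why an inner derivation has
  \<open>\<tau> = 0\<close>, and why a nonzero \<open>\<tau>\<close> has to be excluded by other
  means. The formal obstacle is that the iterated duals of the algebra and of its unitization are
  carriers inside unrelated types. Duality is therefore a relation between a space, a candidate dual
  and a pairing, and linearity and continuity are taken relative to carriers. Splitting and action
  formula are carried from each level to its dual through the pairings, even levels included,
  because the evaluation on an odd level is dual to the canonical embedding on the even level below
  it. The analytic obstacle is that restricting a functional on an even level to the algebra gives a
  map known only to be bounded on bounded sets; its continuity comes from the increasing sequence of
  seminorms.\<close>

definition linear_on :: "'x::complex_vector set \<Rightarrow> ('x \<Rightarrow> 'y::complex_vector) \<Rightarrow> bool" where
  "linear_on S f \<longleftrightarrow>
     (\<forall>x\<in>S. \<forall>y\<in>S. f (x + y) = f x + f y) \<and> (\<forall>a. \<forall>x\<in>S. f (a *\<^sub>C x) = a *\<^sub>C f x)"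

definition seminorm_on :: "'x::complex_vector set \<Rightarrow> ('x \<Rightarrow> real) \<Rightarrow> bool" where
  "seminorm_on S p \<longleftrightarrow>
     (\<forall>x\<in>S. \<forall>y\<in>S. p (x + y) \<le> p x + p y) \<and> (\<forall>a. \<forall>x\<in>S. p (a *\<^sub>C x) = cmod a * p x)"

definition locally_convex :: "('b, 'x::complex_vector) bimodule \<Rightarrow> bool" where
  "locally_convex M \<longleftrightarrow>
     complex_vector.subspace (carrier M) \<and> (\<forall>p\<in>seminorms M. seminorm_on (carrier M) p)"

definition continuous_linear ::
  "('b, 'x::complex_vector) bimodule \<Rightarrow> ('c, 'y::complex_vector) bimodule \<Rightarrow> ('x \<Rightarrow> 'y) \<Rightarrow> bool"
  where
  "continuous_linear M N T \<longleftrightarrow>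
     linear_on (carrier M) T \<and> continuous_map (bimodule_topology M) (bimodule_topology N) T"

text \<open>Packages the scalar field as a target space, so that continuous functionals become a
  special case of \<open>continuous_linear\<close>.\<close>

definition scalar_bimodule :: "(unit, complex) bimodule" where
  "scalar_bimodule = \<lparr>carrier = UNIV, seminorms = {cmod}, lact = \<lambda>_ x. x, ract = \<lambda>x _. x\<rparr>"

lemma carrier_scalar_bimodule [simp]: "carrier scalar_bimodule = UNIV"
  and seminorms_scalar_bimodule [simp]: "seminorms scalar_bimodule = {cmod}"
  by (simp_all add: scalar_bimodule_def)

lemma linear_onD:
  assumes "linear_on S f"
  shows linear_on_add: "x \<in> S \<Longrightarrow> y \<in> S \<Longrightarrow> f (x + y) = f x + f y"
    and linear_on_scale: "x \<in> S \<Longrightarrow> f (a *\<^sub>C x) = a *\<^sub>C f x"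
  using assms by (auto simp: linear_on_def)

lemma linear_on_zero:
  assumes "linear_on S f" "0 \<in> S" shows "f 0 = 0"
  using linear_on_scale[OF assms, of 0] by (simp add: complex_vector.scale_zero_left)

lemma linear_on_diff:
  assumes "linear_on S f" "complex_vector.subspace S" "x \<in> S" "y \<in> S"
  shows "f (x - y) = f x - f y"
proof -
  have "f (x - y + y) = f (x - y) + f y"
    using assms by (intro linear_on_add) (auto intro: complex_vector.subspace_diff)
  then show ?thesis by simp
qed

lemma linear_on_compose:
  assumes "linear_on S f" "linear_on S' g" "f ` S \<subseteq> S'"
  shows "linear_on S (g \<circ> f)"
proof -
  have "f x \<in> S'" if "x \<in> S" for x using assms(3) that by auto
  then show ?thesis using assms(1,2) unfolding linear_on_def by simp
qed

lemma linear_imp_linear_on: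
  assumes "Vector_Spaces.linear scaleC scaleC f" shows "linear_on S f"
proof -
  interpret Vector_Spaces.linear scaleC scaleC f by (rule assms)
  show ?thesis by (simp add: linear_on_def add scale)
qed

lemma linear_on_UNIV: "linear_on UNIV f \<longleftrightarrow> Vector_Spaces.linear scaleC scaleC f"
proof
  assume "linear_on UNIV f"
  then show "Vector_Spaces.linear scaleC scaleC f"
    by unfold_locales (simp_all add: linear_on_def)
qed (rule linear_imp_linear_on)

lemma seminorm_on_zero:
  assumes "seminorm_on S p" "0 \<in> S" shows "p 0 = 0"
proof -
  have "p (0 *\<^sub>C 0) = cmod 0 * p 0" using assms unfolding seminorm_on_def by blast
  then show ?thesis by (simp add: complex_vector.scale_zero_left)
qed

lemma seminorm_on_nonneg:
  assumes "seminorm_on S p" "complex_vector.subspace S" "x \<in> S" shows "0 \<le> p x"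
proof -
  have "p (x + (-1) *\<^sub>C x) \<le> p x + p ((-1) *\<^sub>C x)"
    using assms complex_vector.subspace_scale unfolding seminorm_on_def by blast
  moreover have "p ((-1) *\<^sub>C x) = cmod (-1) * p x"
    using assms unfolding seminorm_on_def by blast
  moreover have "x + (-1) *\<^sub>C x = 0" by (simp add: complex_vector.scale_minus_left scaleC_one)
  ultimately show ?thesis
    using seminorm_on_zero[OF assms(1)] assms(2) by (simp add: complex_vector.subspace_0)
qed

lemma seminorm_on_triangle:
  assumes "seminorm_on S p" "complex_vector.subspace S" "x \<in> S" "y \<in> S" "z \<in> S"
  shows "p (x - z) \<le> p (x - y) + p (y - z)"
proof -
  have "p ((x - y) + (y - z)) \<le> p (x - y) + p (y - z)"
    using assms complex_vector.subspace_diff unfolding seminorm_on_def by blast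
  then show ?thesis by simp
qed

section \<open>Topologies generated by seminorms\<close>

lemma topspace_seminorm_topology [simp]: "topspace (seminorm_topology S P) = S"
  by (auto simp: seminorm_topology_def topology_generated_by_topspace)

lemma topspace_bimodule_topology [simp]: "topspace (bimodule_topology M) = carrier M"
  by (simp add: bimodule_topology_def)

text \<open>The generating semiballs form only a subbasis, with arbitrary centres. The triangle
  inequality recentres a semiball around \<open>z\<close> at any of its points \<open>x\<close>, at
  the price of the radius \<open>e - p (x - z)\<close>; intersections unite the finite sets of
  seminorms and take the smaller radius.\<close>

lemma openin_seminorm_topology:
  assumes S: "complex_vector.subspace S" and P: "\<And>p. p \<in> P \<Longrightarrow> seminorm_on S p"
  shows "openin (seminorm_topology S P) U \<longleftrightarrow> U \<subseteq> S \<and>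
    (\<forall>x\<in>U. \<exists>F e. finite F \<and> F \<subseteq> P \<and> 0 < e \<and> {y \<in> S. \<forall>p\<in>F. p (y - x) < e} \<subseteq> U)"
    (is "_ \<longleftrightarrow> U \<subseteq> S \<and> (\<forall>x\<in>U. ?nbh U x)")
proof (intro iffI conjI ballI)
  assume U: "openin (seminorm_topology S P) U"
  then show "U \<subseteq> S" using openin_subset by fastforce
  fix x assume "x \<in> U"
  have "generate_topology_on (insert S {{y \<in> S. p (y - x) < e} | x p e. x \<in> S \<and> p \<in> P \<and> 0 < e}) U"
    using U by (simp add: seminorm_topology_def openin_topology_generated_by_iff)
  then have "\<forall>x\<in>U. ?nbh U x"
  proof induction
    case Empty
    then show ?case by simp
  next
    case (Int V W)
    show ?case
    proof
      fix x assume x: "x \<in> V \<inter> W"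
      obtain F e where F: "finite F" "F \<subseteq> P" "0 < e" "{y \<in> S. \<forall>p\<in>F. p (y - x) < e} \<subseteq> V"
        using bspec[OF Int.IH(1) IntD1[OF x]] by (elim exE conjE)
      obtain G d where G: "finite G" "G \<subseteq> P" "0 < d" "{y \<in> S. \<forall>p\<in>G. p (y - x) < d} \<subseteq> W"
        using bspec[OF Int.IH(2) IntD2[OF x]] by (elim exE conjE)
      have "{y \<in> S. \<forall>p\<in>F \<union> G. p (y - x) < min e d} \<subseteq> V \<inter> W"
        using F(4) G(4) by auto
      then show "?nbh (V \<inter> W) x"
        using F G by (intro exI[of _ "F \<union> G"] exI[of _ "min e d"]) simp
    qed
  next
    case (UN K)
    show ?case
    proof
      fix x assume "x \<in> \<Union> K"
      then obtain V where V: "V \<in> K" "x \<in> V" by blast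
      obtain F e where F: "finite F" "F \<subseteq> P" "0 < e" "{y \<in> S. \<forall>p\<in>F. p (y - x) < e} \<subseteq> V"
        using bspec[OF UN.IH[OF V(1)] V(2)] by (elim exE conjE)
      moreover have "V \<subseteq> \<Union> K" using V by blast
      ultimately show "?nbh (\<Union> K) x" by (intro exI[of _ F] exI[of _ e]) simp
    qed
  next
    case (Basis V)
    then consider "V = S"
      | z p e where "V = {y \<in> S. p (y - z) < e}" "z \<in> S" "p \<in> P" "0 < e" by blast
    then show ?case
    proof cases
      case 1
      then show ?thesis by (auto intro!: exI[of _ "{}"] exI[of _ "1::real"])
    next
      case 2
      show ?thesis
      proof
        fix x assume x: "x \<in> V"
        have "{y \<in> S. \<forall>p\<in>{p}. p (y - x) < e - p (x - z)} \<subseteq> V"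
          using seminorm_on_triangle[OF P[OF 2(3)] S _ _ 2(2), of _ x] x 2 by fastforce
        then show "?nbh V x"
          using 2 x by (intro exI[of _ "{p}"] exI[of _ "e - p (x - z)"]) simp
      qed
    qed
  qed
  then show "?nbh U x" using \<open>x \<in> U\<close> by (rule bspec)
next
  assume U: "U \<subseteq> S \<and> (\<forall>x\<in>U. ?nbh U x)"
  have sub: "openin (seminorm_topology S P) {y \<in> S. p (y - x) < e}"
    if "x \<in> S" "p \<in> P" "0 < e" for x p e
    unfolding seminorm_topology_def openin_topology_generated_by_iff
    using that by (intro generate_topology_on.Basis) auto
  have fin: "openin (seminorm_topology S P) {y \<in> S. \<forall>p\<in>F. p (y - x) < e}"
    if "finite F" "F \<subseteq> P" "x \<in> S" "0 < e" for F x e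
    using that
  proof (induction F)
    case empty
    show ?case using openin_topspace[of "seminorm_topology S P"] by simp
  next
    case (insert p F)
    have "{y \<in> S. \<forall>p\<in>insert p F. p (y - x) < e}
        = {y \<in> S. p (y - x) < e} \<inter> {y \<in> S. \<forall>p\<in>F. p (y - x) < e}" by auto
    then show ?case using insert sub by (simp add: openin_Int)
  qed
  show "openin (seminorm_topology S P) U"
  proof (subst openin_subopen, intro ballI)
    fix x assume x: "x \<in> U"
    then obtain F e where F: "finite F" "F \<subseteq> P" "0 < e" "{y \<in> S. \<forall>p\<in>F. p (y - x) < e} \<subseteq> U"
      using U by blast
    have "x \<in> S" using U x by blast
    moreover have "p (x - x) < e" if "p \<in> F" for p
      using seminorm_on_zero[OF P[OF subsetD[OF F(2) that]] complex_vector.subspace_0[OF S]] F(3)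
      by simp
    ultimately show "\<exists>T. openin (seminorm_topology S P) T \<and> x \<in> T \<and> T \<subseteq> U"
      using F fin by (intro exI[of _ "{y \<in> S. \<forall>p\<in>F. p (y - x) < e}"]) simp
  qed
qed

lemma openin_bimodule_topology:
  assumes "locally_convex M"
  shows "openin (bimodule_topology M) U \<longleftrightarrow> U \<subseteq> carrier M \<and>
    (\<forall>x\<in>U. \<exists>F e. finite F \<and> F \<subseteq> seminorms M \<and> 0 < e \<and>
       {y \<in> carrier M. \<forall>p\<in>F. p (y - x) < e} \<subseteq> U)"
  using assms by (simp add: bimodule_topology_def locally_convex_def openin_seminorm_topology)

lemma locally_convex_scalar_bimodule [simp]: "locally_convex scalar_bimodule"
  by (simp add: locally_convex_def seminorm_on_def norm_mult norm_triangle_ineq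
      scaleC_complex_def complex_vector.subspace_UNIV)

lemma bimodule_topology_scalar [simp]: "bimodule_topology scalar_bimodule = euclidean"
proof -
  have "(\<exists>F e. finite F \<and> F \<subseteq> {cmod} \<and> 0 < e \<and> {y. \<forall>p\<in>F. p (y - x) < e} \<subseteq> U)
      \<longleftrightarrow> (\<exists>e>0. ball x e \<subseteq> U)" for x U
  proof
    assume "\<exists>F e. finite F \<and> F \<subseteq> {cmod} \<and> 0 < e \<and> {y. \<forall>p\<in>F. p (y - x) < e} \<subseteq> U"
    then show "\<exists>e>0. ball x e \<subseteq> U"
      by (fastforce simp: dist_norm norm_minus_commute)
  next
    assume "\<exists>e>0. ball x e \<subseteq> U"
    then obtain e where "e > 0" "ball x e \<subseteq> U" by blast
    then show "\<exists>F e. finite F \<and> F \<subseteq> {cmod} \<and> 0 < e \<and> {y. \<forall>p\<in>F. p (y - x) < e} \<subseteq> U"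
      by (intro exI[of _ "{cmod}"] exI[of _ e]) (auto simp: dist_norm norm_minus_commute)
  qed
  then show ?thesis
    by (simp add: topology_eq openin_bimodule_topology open_contains_ball)
qed

section \<open>Continuous linear maps and bounded sets\<close>

lemma continuous_linear_mem:
  "continuous_linear M N T \<Longrightarrow> x \<in> carrier M \<Longrightarrow> T x \<in> carrier N"
  unfolding continuous_linear_def continuous_map_def by auto

lemma continuous_linear_linear: "continuous_linear M N T \<Longrightarrow> linear_on (carrier M) T"
  by (simp add: continuous_linear_def)

lemma continuous_linear_compose:
  assumes "continuous_linear M N T" "continuous_linear N K R"
  shows "continuous_linear M K (\<lambda>x. R (T x))"
  using assms linear_on_compose[of "carrier M" T "carrier N" R] continuous_linear_mem[OF assms(1)]
    continuous_map_compose[of "bimodule_topology M" "bimodule_topology N" T "bimodule_topology K" R]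
  by (auto simp: continuous_linear_def comp_def)

text \<open>A general continuity criterion would allow finitely many seminorms on the right-hand
  side. One is enough here: every estimate below, for the algebra seminorms and for the suprema over
  bounded sets alike, involves a single dominating seminorm.\<close>

lemma continuous_linearI:
  assumes M: "locally_convex M" and N: "locally_convex N"
    and lin: "linear_on (carrier M) T" and T: "\<And>x. x \<in> carrier M \<Longrightarrow> T x \<in> carrier N"
    and bd: "\<And>p. p \<in> seminorms N \<Longrightarrow> \<exists>q\<in>seminorms M. \<exists>C. \<forall>x\<in>carrier M. p (T x) \<le> C * q x"
  shows "continuous_linear M N T"
proof -
  have SM: "complex_vector.subspace (carrier M)"
    using M by (simp add: locally_convex_def)
  have "openin (bimodule_topology M) {x \<in> carrier M. T x \<in> U}"
    if U: "openin (bimodule_topology N) U" for U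
    unfolding openin_bimodule_topology[OF M]
  proof (intro conjI ballI)
    fix x assume "x \<in> {x \<in> carrier M. T x \<in> U}"
    then have x: "x \<in> carrier M" "T x \<in> U" by auto
    then obtain F e where F: "finite F" "F \<subseteq> seminorms N" "0 < e"
        "{y \<in> carrier N. \<forall>p\<in>F. p (y - T x) < e} \<subseteq> U"
      using U unfolding openin_bimodule_topology[OF N] by blast
    have "\<exists>q\<in>seminorms M. \<exists>C>0. \<forall>x\<in>carrier M. p (T x) \<le> C * q x" if p: "p \<in> F" for p
    proof -
      obtain q C where q: "q \<in> seminorms M" "\<And>x. x \<in> carrier M \<Longrightarrow> p (T x) \<le> C * q x"
        using bd p F(2) by blast
      have "0 \<le> q x" if "x \<in> carrier M" for x
        using M q(1) that by (auto simp: locally_convex_def intro: seminorm_on_nonneg)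
      \<comment> \<open>The constant is made positive, since it is later multiplied into a strict
        inequality; \<open>q x\<close> being nonnegative allows this.\<close>
      then have "p (T x) \<le> max C 1 * q x" if "x \<in> carrier M" for x
        using q(2)[OF that] mult_right_mono[of C "max C 1" "q x"] that by fastforce
      then show ?thesis using q(1) by (intro bexI[of _ q] exI[of _ "max C 1"]) auto
    qed
    then obtain q C where q: "\<And>p. p \<in> F \<Longrightarrow> q p \<in> seminorms M" "\<And>p. p \<in> F \<Longrightarrow> 0 < C p"
        "\<And>p x. p \<in> F \<Longrightarrow> x \<in> carrier M \<Longrightarrow> p (T x) \<le> C p * q p x"
      by metis
    \<comment> \<open>One constant for all of \<open>F\<close>; the inserted \<open>1\<close> covers
      the empty \<open>F\<close> and makes \<open>K\<close> positive.\<close>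
    define K where "K = Max (insert 1 (C ` F))"
    have K: "0 < K" "\<And>p. p \<in> F \<Longrightarrow> C p \<le> K"
      using F(1) Max_ge[of "insert 1 (C ` F)"] unfolding K_def
      by (auto intro: less_le_trans[OF zero_less_one])
    have "{y \<in> carrier M. \<forall>p\<in>q ` F. p (y - x) < e / K} \<subseteq> {x \<in> carrier M. T x \<in> U}"
    proof
      fix y assume "y \<in> {y \<in> carrier M. \<forall>p\<in>q ` F. p (y - x) < e / K}"
      then have y: "y \<in> carrier M" "\<And>p. p \<in> F \<Longrightarrow> q p (y - x) < e / K" by auto
      have yx: "y - x \<in> carrier M" using SM x y by (simp add: complex_vector.subspace_diff)
      have "p (T y - T x) < e" if "p \<in> F" for p
      proof -
        have "p (T y - T x) \<le> C p * q p (y - x)"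
          using q(3)[OF that yx] linear_on_diff[OF lin SM y(1) x(1)] by simp
        also have "\<dots> < C p * (e / K)"
          using y(2)[OF that] q(2)[OF that] by (rule mult_strict_left_mono)
        also have "\<dots> \<le> K * (e / K)"
          using K(2)[OF that] K(1) F(3) by (intro mult_right_mono) auto
        finally show ?thesis using K(1) by simp
      qed
      then show "y \<in> {x \<in> carrier M. T x \<in> U}"
        using F(4) T y(1) by blast
    qed
    then show "\<exists>F e. finite F \<and> F \<subseteq> seminorms M \<and> 0 < e \<and>
        {y \<in> carrier M. \<forall>p\<in>F. p (y - x) < e} \<subseteq> {x \<in> carrier M. T x \<in> U}"
      using F q K by (intro exI[of _ "q ` F"] exI[of _ "e / K"]) auto
  qed auto
  then show ?thesis
    using lin T by (auto simp: continuous_linear_def continuous_map_def)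
qed

text \<open>Continuity puts a finite intersection of semiballs of radius \<open>e\<close> into the
  preimage of the unit semiball of \<open>p\<close>. The bounded set is scaled by a common factor
  \<open>t\<close> into that intersection, which gives the bound \<open>1 / t\<close> for
  \<open>p\<close> on the image.\<close>

lemma continuous_linear_bounded_image:
  assumes M: "locally_convex M" and N: "locally_convex N"
    and T: "continuous_linear M N T" and B: "bounded_subset M B"
  shows "bounded_subset N (T ` B)"
  unfolding bounded_subset_def
proof (intro conjI ballI)
  have BM: "B \<subseteq> carrier M" using B by (simp add: bounded_subset_def)
  then show "T ` B \<subseteq> carrier N" using continuous_linear_mem[OF T] by auto
  have SM: "complex_vector.subspace (carrier M)" and SN: "complex_vector.subspace (carrier N)"
    using M N by (simp_all add: locally_convex_def)
  have lin: "linear_on (carrier M) T" using T by (rule continuous_linear_linear)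
  have T0: "T 0 = 0" using linear_on_zero[OF lin] SM complex_vector.subspace_0 by blast
  fix p assume p: "p \<in> seminorms N"
  then have pN: "seminorm_on (carrier N) p" using N by (simp add: locally_convex_def)
  have "openin (bimodule_topology N) {y \<in> carrier N. p (y - 0) < 1}"
    unfolding bimodule_topology_def seminorm_topology_def openin_topology_generated_by_iff
    using p SN complex_vector.subspace_0
    by (intro generate_topology_on.Basis insertI2 CollectI exI[of _ 0] exI[of _ p] exI[of _ 1]) auto
  then have "openin (bimodule_topology M) {x \<in> carrier M. T x \<in> {y \<in> carrier N. p (y - 0) < 1}}"
    using T unfolding continuous_linear_def continuous_map_def by auto
  moreover have "0 \<in> {x \<in> carrier M. T x \<in> {y \<in> carrier N. p (y - 0) < 1}}"
    using SM SN T0 seminorm_on_zero[OF pN] by (simp add: complex_vector.subspace_0)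
  ultimately obtain F e where F: "finite F" "F \<subseteq> seminorms M" "0 < e"
      and sub: "{y \<in> carrier M. \<forall>q\<in>F. q (y - 0) < e} \<subseteq>
        {x \<in> carrier M. T x \<in> {y \<in> carrier N. p (y - 0) < 1}}"
    unfolding openin_bimodule_topology[OF M] by blast
  have "\<forall>q\<in>F. \<exists>K. \<forall>x\<in>B. q x \<le> K"
    using B F(2) unfolding bounded_subset_def bdd_above_def by blast
  then obtain K where K: "\<And>q x. q \<in> F \<Longrightarrow> x \<in> B \<Longrightarrow> q x \<le> K q" by metis
  define L where "L = Max (insert 1 (K ` F))"
  have L: "0 < L" "\<And>q. q \<in> F \<Longrightarrow> K q \<le> L"
    using F(1) Max_ge[of "insert 1 (K ` F)"] unfolding L_def
    by (auto intro: less_le_trans[OF zero_less_one])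
  \<comment> \<open>The factor \<open>2\<close> gives \<open>t * L = e / 2\<close>, strictly inside
    the semiballs of radius \<open>e\<close>.\<close>
  define t where "t = e / (2 * L)"
  have t: "0 < t" using F(3) L(1) by (simp add: t_def)
  have "p (T x) \<le> 1 / t" if x: "x \<in> B" for x
  proof -
    have xM: "x \<in> carrier M" using x BM by blast
    have "q (complex_of_real t *\<^sub>C x) < e" if q: "q \<in> F" for q
    proof -
      have "q (complex_of_real t *\<^sub>C x) = cmod (complex_of_real t) * q x"
        using M q F(2) xM unfolding locally_convex_def seminorm_on_def by blast
      also have "\<dots> \<le> t * L" using t K[OF q x] L(2)[OF q] by simp
      also have "\<dots> < e" using F(3) L(1) by (simp add: t_def)
      finally show ?thesis .
    qed
    moreover have "complex_of_real t *\<^sub>C x \<in> carrier M"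
      using SM xM by (simp add: complex_vector.subspace_scale)
    ultimately have "p (T (complex_of_real t *\<^sub>C x)) < 1" using sub by auto
    moreover have "p (T (complex_of_real t *\<^sub>C x)) = cmod (complex_of_real t) * p (T x)"
      using pN continuous_linear_mem[OF T xM] linear_on_scale[OF lin xM]
      unfolding seminorm_on_def by simp
    ultimately show ?thesis using t by (simp add: field_simps)
  qed
  then show "bdd_above (p ` T ` B)" by (auto intro!: bdd_aboveI2[where M = "1 / t"] simp: image_image)
qed

lemma continuous_linear_cong:
  assumes "\<And>x. x \<in> carrier M \<Longrightarrow> f x = g x" and f: "continuous_linear M N f"
    and M: "locally_convex M"
  shows "continuous_linear M N g"
proof -
  have S: "complex_vector.subspace (carrier M)" using M by (simp add: locally_convex_def)
  have "linear_on (carrier M) g"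
    using continuous_linear_linear[OF f] assms(1)
      complex_vector.subspace_add[OF S] complex_vector.subspace_scale[OF S]
    unfolding linear_on_def by metis
  moreover have "continuous_map (bimodule_topology M) (bimodule_topology N) g"
    using f assms(1) by (auto simp: continuous_linear_def elim: continuous_map_eq)
  ultimately show ?thesis by (simp add: continuous_linear_def)
qed

lemma continuous_functionals_iff:
  "f \<in> continuous_functionals M \<longleftrightarrow>
     continuous_linear M scalar_bimodule f \<and> (\<forall>x. x \<notin> carrier M \<longrightarrow> f x = 0)"
  by (auto simp: continuous_functionals_def continuous_linear_def linear_on_def scaleC_complex_def)

lemma continuous_functional_bounded:
  assumes "locally_convex M" "continuous_linear M scalar_bimodule f" "bounded_subset M S"
  shows "bdd_above ((\<lambda>x. cmod (f x)) ` S)"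
  using continuous_linear_bounded_image[OF assms(1) _ assms(2,3)]
  by (simp add: bounded_subset_def image_image)

section \<open>Bimodules and strong duals\<close>

definition locally_convex_bimodule ::
  "('b::complex_vector, 'x::complex_vector) bimodule \<Rightarrow> bool" where
  "locally_convex_bimodule M \<longleftrightarrow> locally_convex M \<and>
     (\<forall>b. continuous_linear M M (lact M b)) \<and> (\<forall>b. continuous_linear M M (\<lambda>x. ract M x b)) \<and>
     (\<forall>x\<in>carrier M. linear_on UNIV (\<lambda>b. lact M b x) \<and> linear_on UNIV (ract M x))"

lemma locally_convex_bimoduleD:
  assumes "locally_convex_bimodule M"
  shows "locally_convex M" "complex_vector.subspace (carrier M)"
    "continuous_linear M M (lact M b)" "continuous_linear M M (\<lambda>x. ract M x b)"
    "x \<in> carrier M \<Longrightarrow> lact M b x \<in> carrier M" "x \<in> carrier M \<Longrightarrow> ract M x b \<in> carrier M"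
    "x \<in> carrier M \<Longrightarrow> linear_on UNIV (\<lambda>b. lact M b x)" "x \<in> carrier M \<Longrightarrow> linear_on UNIV (ract M x)"
  using assms continuous_linear_mem[of M M "lact M b"] continuous_linear_mem[of M M "\<lambda>x. ract M x b"]
  by (auto simp: locally_convex_bimodule_def locally_convex_def)

text \<open>\<open>N\<close> is the strong dual of \<open>M\<close> through the pairing \<open>B\<close>, whatever type the elements of
  \<open>N\<close> live in.\<close>

definition strong_dual ::
  "('b, 'x::complex_vector) bimodule \<Rightarrow> ('b, 'y::complex_vector) bimodule \<Rightarrow>
   ('y \<Rightarrow> 'x \<Rightarrow> complex) \<Rightarrow> bool" where
  "strong_dual M N B \<longleftrightarrow>
     complex_vector.subspace (carrier N) \<and>
     (\<forall>x\<in>carrier M. linear_on (carrier N) (\<lambda>f. B f x)) \<and>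
     (\<forall>f\<in>carrier N. continuous_linear M scalar_bimodule (B f)) \<and>
     (\<forall>g. continuous_linear M scalar_bimodule g \<longrightarrow>
          (\<exists>f\<in>carrier N. \<forall>x\<in>carrier M. B f x = g x)) \<and>
     (\<forall>f\<in>carrier N. (\<forall>x\<in>carrier M. B f x = 0) \<longrightarrow> f = 0) \<and>
     (\<forall>q\<in>seminorms N. \<exists>S. bounded_subset M S \<and> S \<noteq> {} \<and>
          (\<forall>f\<in>carrier N. q f = (SUP x\<in>S. cmod (B f x)))) \<and>
     (\<forall>S. bounded_subset M S \<and> S \<noteq> {} \<longrightarrow>
          (\<exists>q\<in>seminorms N. \<forall>f\<in>carrier N. q f = (SUP x\<in>S. cmod (B f x)))) \<and>
     (\<forall>b. \<forall>f\<in>carrier N. lact N b f \<in> carrier N \<and>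
          (\<forall>x\<in>carrier M. B (lact N b f) x = B f (ract M x b))) \<and>
     (\<forall>b. \<forall>f\<in>carrier N. ract N f b \<in> carrier N \<and>
          (\<forall>x\<in>carrier M. B (ract N f b) x = B f (lact M b x)))"

lemma strong_dual_subspace: "strong_dual M N B \<Longrightarrow> complex_vector.subspace (carrier N)"
  unfolding strong_dual_def by (elim conjE)

lemma strong_dual_linear:
  "strong_dual M N B \<Longrightarrow> x \<in> carrier M \<Longrightarrow> linear_on (carrier N) (\<lambda>f. B f x)"
  unfolding strong_dual_def by (elim conjE) (rule bspec)

lemma strong_dual_continuous:
  "strong_dual M N B \<Longrightarrow> f \<in> carrier N \<Longrightarrow> continuous_linear M scalar_bimodule (B f)"
  unfolding strong_dual_def by (elim conjE) (rule bspec)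

lemma strong_dual_represent:
  assumes "strong_dual M N B" "continuous_linear M scalar_bimodule g"
  obtains f where "f \<in> carrier N" "\<And>x. x \<in> carrier M \<Longrightarrow> B f x = g x"
  using assms unfolding strong_dual_def by meson

lemma strong_dual_eqI:
  assumes "strong_dual M N B" "f \<in> carrier N" "g \<in> carrier N"
    "\<And>x. x \<in> carrier M \<Longrightarrow> B f x = B g x"
  shows "f = g"
proof -
  have "f - g = 0"
  proof -
    have "B (f - g) x = 0" if "x \<in> carrier M" for x
      using linear_on_diff[OF strong_dual_linear[OF assms(1) that] strong_dual_subspace[OF assms(1)]]
        assms(2-4) that by simp
    moreover have "f - g \<in> carrier N"
      using assms(2,3) strong_dual_subspace[OF assms(1)] by (simp add: complex_vector.subspace_diff)
    moreover have "\<forall>f\<in>carrier N. (\<forall>x\<in>carrier M. B f x = 0) \<longrightarrow> f = 0"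
      using assms(1) unfolding strong_dual_def by (elim conjE)
    ultimately show ?thesis by blast
  qed
  then show ?thesis by simp
qed

lemma strong_dual_linearI:
  assumes B: "strong_dual M N B" and S: "complex_vector.subspace S"
    and F: "\<And>a. a \<in> S \<Longrightarrow> F a \<in> carrier N"
    and lin: "\<And>x. x \<in> carrier M \<Longrightarrow> linear_on S (\<lambda>a. B (F a) x)"
  shows "linear_on S F"
  unfolding linear_on_def
proof (intro conjI ballI allI)
  note subN = strong_dual_subspace[OF B]
  fix a b assume a: "a \<in> S" and b: "b \<in> S"
  show "F (a + b) = F a + F b"
  proof (rule strong_dual_eqI[OF B F])
    show "a + b \<in> S" using S a b by (rule complex_vector.subspace_add)
    show "F a + F b \<in> carrier N" using subN F[OF a] F[OF b] by (rule complex_vector.subspace_add)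
    show "B (F (a + b)) x = B (F a + F b) x" if x: "x \<in> carrier M" for x
      using linear_on_add[OF strong_dual_linear[OF B x] F[OF a] F[OF b]] linear_on_add[OF lin[OF x] a b]
      by simp
  qed
next
  note subN = strong_dual_subspace[OF B]
  fix z a assume a: "a \<in> S"
  show "F (z *\<^sub>C a) = z *\<^sub>C F a"
  proof (rule strong_dual_eqI[OF B F])
    show "z *\<^sub>C a \<in> S" using S a by (rule complex_vector.subspace_scale)
    show "z *\<^sub>C F a \<in> carrier N" using subN F[OF a] by (rule complex_vector.subspace_scale)
    show "B (F (z *\<^sub>C a)) x = B (z *\<^sub>C F a) x" if x: "x \<in> carrier M" for x
      using linear_on_scale[OF strong_dual_linear[OF B x] F[OF a]] linear_on_scale[OF lin[OF x] a]
      by simp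
  qed
qed

lemma linear_on_cong:
  assumes "\<And>x. x \<in> S \<Longrightarrow> f x = g x" "complex_vector.subspace S" "linear_on S f"
  shows "linear_on S g"
  using assms by (simp add: linear_on_def complex_vector.subspace_add complex_vector.subspace_scale)

lemma strong_dual_seminorm:
  assumes "strong_dual M N B" "q \<in> seminorms N"
  obtains S where "bounded_subset M S" "S \<noteq> {}"
    "\<And>f. f \<in> carrier N \<Longrightarrow> q f = (SUP x\<in>S. cmod (B f x))"
  using assms unfolding strong_dual_def by meson

lemma strong_dual_bounded:
  assumes "strong_dual M N B" "bounded_subset M S" "S \<noteq> {}"
  obtains q where "q \<in> seminorms N" "\<And>f. f \<in> carrier N \<Longrightarrow> q f = (SUP x\<in>S. cmod (B f x))"
  using assms unfolding strong_dual_def by meson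

lemma strong_dual_lact:
  assumes "strong_dual M N B" "f \<in> carrier N"
  shows "lact N b f \<in> carrier N" "x \<in> carrier M \<Longrightarrow> B (lact N b f) x = B f (ract M x b)"
  using assms unfolding strong_dual_def by meson+

lemma strong_dual_ract:
  assumes "strong_dual M N B" "f \<in> carrier N"
  shows "ract N f b \<in> carrier N" "x \<in> carrier M \<Longrightarrow> B (ract N f b) x = B f (lact M b x)"
  using assms unfolding strong_dual_def by meson+

lemma SUP_cmod_le_seminorm:
  assumes "strong_dual M N B" "locally_convex M" "f \<in> carrier N" "bounded_subset M S" "x \<in> S"
  shows "cmod (B f x) \<le> (SUP x\<in>S. cmod (B f x))"
  using continuous_functional_bounded[OF assms(2) strong_dual_continuous[OF assms(1,3)] assms(4)]
    assms(5) by (rule cSUP_upper[rotated])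

text \<open>The suprema are finite because a continuous functional is bounded on bounded sets.
  Homogeneity is first shown as an inequality; the reverse one follows by scaling back with
  \<open>inverse a\<close>.\<close>

lemma locally_convex_strong_dual:
  assumes B: "strong_dual M N B" and M: "locally_convex M"
  shows "locally_convex N"
  unfolding locally_convex_def
proof (intro conjI ballI)
  show sub: "complex_vector.subspace (carrier N)" by (rule strong_dual_subspace[OF B])
  fix q assume "q \<in> seminorms N"
  then obtain S where S: "bounded_subset M S" "S \<noteq> {}"
      and q: "\<And>f. f \<in> carrier N \<Longrightarrow> q f = (SUP x\<in>S. cmod (B f x))"
    by (rule strong_dual_seminorm[OF B]) blast
  have SM: "\<And>x. x \<in> S \<Longrightarrow> x \<in> carrier M" using S(1) by (auto simp: bounded_subset_def)
  have le: "cmod (B f x) \<le> q f" if "f \<in> carrier N" "x \<in> S" for f x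
    using SUP_cmod_le_seminorm[OF B M that(1) S(1) that(2)] q[OF that(1)] by simp
  have scale: "q (a *\<^sub>C f) \<le> cmod a * q f" if f: "f \<in> carrier N" for a f
  proof -
    have af: "a *\<^sub>C f \<in> carrier N" using sub f by (simp add: complex_vector.subspace_scale)
    have "cmod (B (a *\<^sub>C f) x) \<le> cmod a * q f" if "x \<in> S" for x
      using linear_on_scale[OF strong_dual_linear[OF B SM[OF that]] f, of a] le[OF f that]
      by (simp add: scaleC_complex_def norm_mult mult_left_mono)
    then show ?thesis unfolding q[OF af] by (rule cSUP_least[OF S(2)])
  qed
  show "seminorm_on (carrier N) q"
    unfolding seminorm_on_def
  proof (intro conjI ballI allI)
    fix f g assume f: "f \<in> carrier N" and g: "g \<in> carrier N"
    have fg: "f + g \<in> carrier N" using sub f g by (simp add: complex_vector.subspace_add)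
    have "cmod (B (f + g) x) \<le> q f + q g" if "x \<in> S" for x
      using linear_on_add[OF strong_dual_linear[OF B SM[OF that]] f g] le[OF f that] le[OF g that]
        norm_triangle_ineq[of "B f x" "B g x"] by simp
    then show "q (f + g) \<le> q f + q g" unfolding q[OF fg] by (rule cSUP_least[OF S(2)])
  next
    fix a f assume f: "f \<in> carrier N"
    show "q (a *\<^sub>C f) = cmod a * q f"
    proof (cases "a = 0")
      case True
      have "q 0 = (SUP x\<in>S. 0)"
        unfolding q[OF complex_vector.subspace_0[OF sub]]
        using linear_on_zero[OF strong_dual_linear[OF B SM] complex_vector.subspace_0[OF sub]]
        by (intro SUP_cong) simp_all
      then show ?thesis using True S(2) by (simp add: complex_vector.scale_zero_left)
    next
      case False
      have af: "a *\<^sub>C f \<in> carrier N" using sub f by (simp add: complex_vector.subspace_scale)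
      have "q f = q (inverse a *\<^sub>C a *\<^sub>C f)" using False by (simp add: scaleC_scaleC scaleC_one)
      also have "\<dots> \<le> cmod (inverse a) * q (a *\<^sub>C f)" by (rule scale[OF af])
      finally have "cmod a * q f \<le> q (a *\<^sub>C f)"
        unfolding norm_inverse using False by (simp add: field_simps)
      with scale[OF f, of a] show ?thesis by simp
    qed
  qed
qed

lemma adjoint_continuous_linear:
  fixes M :: "('b, 'x::complex_vector) bimodule" and M' :: "('b, 'y::complex_vector) bimodule"
    and N :: "('c, 'z::complex_vector) bimodule" and N' :: "('c, 'w::complex_vector) bimodule"
  assumes B: "strong_dual M M' B" and C: "strong_dual N N' C"
    and M: "locally_convex M" and N: "locally_convex N" and T: "continuous_linear M N T"
  obtains T' where "continuous_linear N' M' T'"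
    "\<And>f x. f \<in> carrier N' \<Longrightarrow> x \<in> carrier M \<Longrightarrow> B (T' f) x = C f (T x)"
proof -
  have "\<exists>g. g \<in> carrier M' \<and> (\<forall>x\<in>carrier M. B g x = C f (T x))" if "f \<in> carrier N'" for f
    using strong_dual_represent[OF B continuous_linear_compose[OF T strong_dual_continuous[OF C that]]]
    by metis
  then obtain T' where T': "\<And>f. f \<in> carrier N' \<Longrightarrow> T' f \<in> carrier M'"
      "\<And>f x. f \<in> carrier N' \<Longrightarrow> x \<in> carrier M \<Longrightarrow> B (T' f) x = C f (T x)"
    by metis
  note subN = strong_dual_subspace[OF C]
  have "continuous_linear N' M' T'"
  proof (rule continuous_linearI)
    show "locally_convex N'" by (rule locally_convex_strong_dual[OF C N])
    show "locally_convex M'" by (rule locally_convex_strong_dual[OF B M])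
    show "linear_on (carrier N') T'"
    proof (rule strong_dual_linearI[OF B subN T'(1)])
      fix x assume x: "x \<in> carrier M"
      show "linear_on (carrier N') (\<lambda>f. B (T' f) x)"
        using T'(2)[OF _ x, symmetric] subN strong_dual_linear[OF C continuous_linear_mem[OF T x]] by (rule linear_on_cong)
    qed
  next
    fix p assume "p \<in> seminorms M'"
    then obtain S where S: "bounded_subset M S" "S \<noteq> {}"
        and p: "\<And>f. f \<in> carrier M' \<Longrightarrow> p f = (SUP x\<in>S. cmod (B f x))"
      by (rule strong_dual_seminorm[OF B]) blast
    obtain q where q: "q \<in> seminorms N'"
        "\<And>f. f \<in> carrier N' \<Longrightarrow> q f = (SUP x\<in>T ` S. cmod (C f x))"
      by (rule strong_dual_bounded[OF C continuous_linear_bounded_image[OF M N T S(1)]]) (use S(2) in auto)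
    have SM: "x \<in> carrier M" if "x \<in> S" for x using S(1) that by (auto simp: bounded_subset_def)
    have "p (T' f) = q f" if f: "f \<in> carrier N'" for f
      unfolding p[OF T'(1)[OF f]] q(2)[OF f] image_image
      by (intro SUP_cong) (simp_all add: T'(2)[OF f SM])
    then have "\<forall>f\<in>carrier N'. p (T' f) \<le> 1 * q f" by simp
    then show "\<exists>q\<in>seminorms N'. \<exists>C. \<forall>f\<in>carrier N'. p (T' f) \<le> C * q f"
      using q(1) by blast
  qed (rule T'(1))
  then show ?thesis using T'(2) by (rule that)
qed

text \<open>Each action on the dual is the adjoint of the opposite action on \<open>M\<close>, so
  its continuity is that of an adjoint. Linearity in the algebra variable is read off through the
  pairing.\<close>

lemma locally_convex_bimodule_strong_dual:
  assumes B: "strong_dual M N B" and M: "locally_convex_bimodule M"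
  shows "locally_convex_bimodule N"
  unfolding locally_convex_bimodule_def
proof (intro conjI allI ballI)
  note lc = locally_convex_bimoduleD[OF M]
  show N: "locally_convex N" using B lc(1) by (rule locally_convex_strong_dual)
  fix b
  obtain T where T: "continuous_linear N N T"
      "\<And>f x. f \<in> carrier N \<Longrightarrow> x \<in> carrier M \<Longrightarrow> B (T f) x = B f (ract M x b)"
    using adjoint_continuous_linear[OF B B lc(1,1,4)] by blast
  have "T f = lact N b f" if "f \<in> carrier N" for f
    using that T(2) strong_dual_lact[OF B that]
    by (intro strong_dual_eqI[OF B]) (simp_all add: continuous_linear_mem[OF T(1)])
  then show "continuous_linear N N (lact N b)" using T(1) N by (rule continuous_linear_cong)
next
  note lc = locally_convex_bimoduleD[OF M]
  have N: "locally_convex N" using B lc(1) by (rule locally_convex_strong_dual)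
  fix b
  obtain T where T: "continuous_linear N N T"
      "\<And>f x. f \<in> carrier N \<Longrightarrow> x \<in> carrier M \<Longrightarrow> B (T f) x = B f (lact M b x)"
    using adjoint_continuous_linear[OF B B lc(1,1,3)] by blast
  have "T f = ract N f b" if "f \<in> carrier N" for f
    using that T(2) strong_dual_ract[OF B that]
    by (intro strong_dual_eqI[OF B]) (simp_all add: continuous_linear_mem[OF T(1)])
  then show "continuous_linear N N (\<lambda>f. ract N f b)" using T(1) N by (rule continuous_linear_cong)
next
  note lc = locally_convex_bimoduleD[OF M]
  fix f assume f: "f \<in> carrier N"
  note lin = continuous_linear_linear[OF strong_dual_continuous[OF B f]]
  show "linear_on UNIV (\<lambda>b. lact N b f)"
  proof (rule strong_dual_linearI[OF B complex_vector.subspace_UNIV strong_dual_lact(1)[OF B f]])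
    fix x assume x: "x \<in> carrier M"
    show "linear_on UNIV (\<lambda>b. B (lact N b f) x)"
      using linear_on_compose[OF lc(8)[OF x] lin] lc(6)[OF x]
      by (simp add: strong_dual_lact(2)[OF B f x] comp_def image_subset_iff)
  qed
  show "linear_on UNIV (ract N f)"
  proof (rule strong_dual_linearI[OF B complex_vector.subspace_UNIV strong_dual_ract(1)[OF B f]])
    fix x assume x: "x \<in> carrier M"
    show "linear_on UNIV (\<lambda>b. B (ract N f b) x)"
      using linear_on_compose[OF lc(7)[OF x] lin] lc(5)[OF x]
      by (simp add: strong_dual_ract(2)[OF B f x] comp_def image_subset_iff)
  qed
qed

text \<open>The pairing is evaluation. A functional continuous on the carrier can take any values
  outside it; cutting it off to \<open>0\<close> there selects the representative that belongs to
  \<open>continuous_functionals\<close>.\<close>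

lemma strong_dual_dual_bimodule:
  assumes M: "locally_convex_bimodule M"
  shows "strong_dual M (dual_bimodule M) (\<lambda>f. f)"
proof -
  note lc = locally_convex_bimoduleD[OF M]
  let ?N = "dual_bimodule M"
  have car: "f \<in> carrier ?N \<longleftrightarrow>
      continuous_linear M scalar_bimodule f \<and> (\<forall>x. x \<notin> carrier M \<longrightarrow> f x = 0)" for f
    by (simp add: dual_bimodule_def continuous_functionals_iff)
  have restrict: "(\<lambda>x. if x \<in> carrier M then g x else 0) \<in> carrier ?N"
    if "continuous_linear M scalar_bimodule g" for g
    unfolding car using that by (auto intro: continuous_linear_cong[OF _ that lc(1)])
  have "complex_vector.subspace (carrier ?N)"
  proof (rule complex_vector.subspaceI)
    show "0 \<in> carrier ?N"
      by (simp add: car continuous_linear_def linear_on_def scaleC_complex_def zero_fun_def)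
  next
    fix f g assume "f \<in> carrier ?N" "g \<in> carrier ?N"
    then show "f + g \<in> carrier ?N"
      by (simp add: car continuous_linear_def linear_on_def scaleC_complex_def plus_fun_def
          continuous_map_add algebra_simps)
  next
    fix a f assume f: "f \<in> carrier ?N"
    have "continuous_linear scalar_bimodule scalar_bimodule ((*) a)"
      by (simp add: continuous_linear_def linear_on_def scaleC_complex_def distrib_left
          continuous_on_mult_left)
    with f show "a *\<^sub>C f \<in> carrier ?N"
      unfolding car scaleC_fun_def scaleC_complex_def by (auto intro: continuous_linear_compose)
  qed
  then show ?thesis
    unfolding strong_dual_def
    apply (intro conjI)
    subgoal .
    subgoal by (simp add: linear_on_def scaleC_fun_def)
    subgoal by (simp add: car)
    subgoal using restrict by (metis (mono_tags, lifting))
    subgoal by (auto simp: car fun_eq_iff)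
    subgoal by (auto simp: dual_bimodule_def)
    subgoal by (auto simp: dual_bimodule_def)
    subgoal
    proof (intro allI ballI conjI)
      fix b f assume "f \<in> carrier ?N"
      then have "continuous_linear M scalar_bimodule f" by (simp add: car)
      from restrict[OF continuous_linear_compose[OF lc(4) this]]
      show "lact ?N b f \<in> carrier ?N" by (simp add: dual_bimodule_def)
    qed (simp add: dual_bimodule_def)
    subgoal
    proof (intro allI ballI conjI)
      fix b f assume "f \<in> carrier ?N"
      then have "continuous_linear M scalar_bimodule f" by (simp add: car)
      from restrict[OF continuous_linear_compose[OF lc(3) this]]
      show "ract ?N f b \<in> carrier ?N" by (simp add: dual_bimodule_def)
    qed (simp add: dual_bimodule_def)
    done
qed

section \<open>Transport along linear injections, and the levels of the iterated dual\<close>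

lemma linear_on_inv_into:
  assumes "Vector_Spaces.linear scaleC scaleC h" "inj_on h S" "complex_vector.subspace S"
  shows "linear_on (h ` S) (inv_into S h)"
proof -
  interpret Vector_Spaces.linear scaleC scaleC h by (rule assms(1))
  show ?thesis
    unfolding linear_on_def using assms(2,3)
    by (auto simp: add[symmetric] scale[symmetric] complex_vector.subspace_add
        complex_vector.subspace_scale)
qed

lemma subspace_linear_image:
  assumes "Vector_Spaces.linear scaleC scaleC h" "complex_vector.subspace S"
  shows "complex_vector.subspace (h ` S)"
proof -
  interpret Vector_Spaces.linear scaleC scaleC h by (rule assms(1))
  show ?thesis using assms(2) by (rule subspace_image)
qed

lemma transport_simps:
  "carrier (transport h M) = h ` carrier M"
  "seminorms (transport h M) = (\<lambda>p y. p (inv_into (carrier M) h y)) ` seminorms M"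
  "lact (transport h M) b y = h (lact M b (inv_into (carrier M) h y))"
  "ract (transport h M) y b = h (ract M (inv_into (carrier M) h y) b)"
  by (auto simp: transport_def Let_def)

lemma transport_locally_convex:
  assumes h: "Vector_Spaces.linear scaleC scaleC h" "inj_on h (carrier M)" and M: "locally_convex M"
  shows "locally_convex (transport h M)"
    and "continuous_linear M (transport h M) h"
    and "continuous_linear (transport h M) M (inv_into (carrier M) h)"
proof -
  have S: "complex_vector.subspace (carrier M)" using M by (simp add: locally_convex_def)
  have hS: "complex_vector.subspace (h ` carrier M)" by (rule subspace_linear_image[OF h(1) S])
  have inv: "linear_on (h ` carrier M) (inv_into (carrier M) h)"
    by (rule linear_on_inv_into[OF h S])
  have mem: "inv_into (carrier M) h y \<in> carrier M" if "y \<in> h ` carrier M" for y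
    using that by (rule inv_into_into)
  show lc: "locally_convex (transport h M)"
    using hS M unfolding locally_convex_def transport_simps seminorm_on_def
    by (auto simp del: inv_into_f_f simp: mem linear_on_add[OF inv] linear_on_scale[OF inv])
  show "continuous_linear M (transport h M) h"
  proof (rule continuous_linearI[OF M lc])
    show "linear_on (carrier M) h" by (rule linear_imp_linear_on[OF h(1)])
    fix p assume "p \<in> seminorms (transport h M)"
    then obtain q where q: "q \<in> seminorms M" "p = (\<lambda>y. q (inv_into (carrier M) h y))"
      by (auto simp: transport_simps)
    have "\<forall>x\<in>carrier M. p (h x) \<le> 1 * q x" using h(2) by (simp add: q(2))
    then show "\<exists>q\<in>seminorms M. \<exists>C. \<forall>x\<in>carrier M. p (h x) \<le> C * q x" using q(1) by blast
  qed (simp add: transport_simps)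
  show "continuous_linear (transport h M) M (inv_into (carrier M) h)"
  proof (rule continuous_linearI[OF lc M])
    show "linear_on (carrier (transport h M)) (inv_into (carrier M) h)"
      using inv by (simp add: transport_simps)
    fix p assume p: "p \<in> seminorms M"
    then show "\<exists>q\<in>seminorms (transport h M). \<exists>C. \<forall>y\<in>carrier (transport h M).
        p (inv_into (carrier M) h y) \<le> C * q y"
      unfolding transport_simps
      by (intro bexI[of _ "\<lambda>y. p (inv_into (carrier M) h y)"] exI[of _ 1]) auto
  qed (simp add: transport_simps mem)
qed

lemma transport_locally_convex_bimodule:
  assumes h: "Vector_Spaces.linear scaleC scaleC h" "inj_on h (carrier M)"
    and M: "locally_convex_bimodule M"
  shows "locally_convex_bimodule (transport h M)"
proof -
  note lc = locally_convex_bimoduleD[OF M] and tr = transport_locally_convex[OF h lc(1)]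
  have "continuous_linear (transport h M) (transport h M) (lact (transport h M) b)" for b
    using continuous_linear_compose[OF continuous_linear_compose[OF tr(3) lc(3)] tr(2), of b]
    by (simp add: transport_simps[abs_def])
  moreover have "continuous_linear (transport h M) (transport h M) (\<lambda>x. ract (transport h M) x b)" for b
    using continuous_linear_compose[OF continuous_linear_compose[OF tr(3) lc(4)] tr(2), of b]
    by (simp add: transport_simps)
  moreover have "linear_on UNIV (\<lambda>b. lact (transport h M) b y)" "linear_on UNIV (ract (transport h M) y)"
    if "y \<in> carrier (transport h M)" for y
    using continuous_linear_mem[OF tr(3) that] linear_imp_linear_on[OF h(1), of UNIV]
      linear_on_compose[OF lc(7) _ subset_UNIV] linear_on_compose[OF lc(8) _ subset_UNIV]
    by (simp_all add: transport_simps[abs_def] comp_def)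
  ultimately show ?thesis using tr(1) by (simp add: locally_convex_bimodule_def)
qed

text \<open>Being a strong dual does not depend on the copy of the dual, once the pairing is
  composed with the inverse of the embedding. This brings the functionals, embedded by
  \<open>c k\<close>, into the scope of \<open>strong_dual\<close>.\<close>

lemma strong_dual_transport_right:
  assumes B: "strong_dual M N B"
    and h: "Vector_Spaces.linear scaleC scaleC h" "inj_on h (carrier N)"
  shows "strong_dual M (transport h N) (\<lambda>f. B (inv_into (carrier N) h f))"
proof -
  note sub = strong_dual_subspace[OF B]
  let ?g = "inv_into (carrier N) h"
  have inv: "linear_on (h ` carrier N) ?g" by (rule linear_on_inv_into[OF h sub])
  have h0: "h 0 = 0"
    using linear_on_zero[OF linear_imp_linear_on[OF h(1)] complex_vector.subspace_0[OF sub]] .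
  show ?thesis
    unfolding strong_dual_def transport_simps
    apply (intro conjI)
    subgoal by (rule subspace_linear_image[OF h(1) sub])
    subgoal
    proof
      fix x assume "x \<in> carrier M"
      from linear_on_compose[OF inv strong_dual_linear[OF B this]]
      show "linear_on (h ` carrier N) (\<lambda>f. B (?g f) x)"
        using h(2) by (simp add: comp_def image_subset_iff)
    qed
    subgoal using strong_dual_continuous[OF B] h(2) by simp
    subgoal using strong_dual_represent[OF B] h(2) by (metis imageI inv_into_f_f)
    subgoal
    proof (intro ballI impI)
      fix f assume f: "f \<in> h ` carrier N" "\<forall>x\<in>carrier M. B (?g f) x = 0"
      have "?g f = 0"
      proof (rule strong_dual_eqI[OF B])
        fix x assume x: "x \<in> carrier M"
        show "B (?g f) x = B 0 x"
          using f(2) x linear_on_zero[OF strong_dual_linear[OF B x] complex_vector.subspace_0[OF sub]]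
          by simp
      qed (use f(1) complex_vector.subspace_0[OF sub] in \<open>auto intro: inv_into_into\<close>)
      then show "f = 0" using f(1) h0 by (metis f_inv_into_f)
    qed
    subgoal
    proof
      fix q assume "q \<in> (\<lambda>p y. p (?g y)) ` seminorms N"
      then obtain p where p: "p \<in> seminorms N" "q = (\<lambda>y. p (?g y))" by blast
      obtain S where "bounded_subset M S" "S \<noteq> {}"
          "\<And>f. f \<in> carrier N \<Longrightarrow> p f = (SUP x\<in>S. cmod (B f x))"
        by (rule strong_dual_seminorm[OF B p(1)]) blast
      then show "\<exists>S. bounded_subset M S \<and> S \<noteq> {} \<and>
          (\<forall>f\<in>h ` carrier N. q f = (SUP x\<in>S. cmod (B (?g f) x)))"
        using h(2) p(2) by (intro exI[of _ S]) simp
    qed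
    subgoal
    proof (intro allI impI)
      fix S assume "bounded_subset M S \<and> S \<noteq> {}"
      then obtain q where "q \<in> seminorms N" "\<And>f. f \<in> carrier N \<Longrightarrow> q f = (SUP x\<in>S. cmod (B f x))"
        using strong_dual_bounded[OF B] by metis
      then show "\<exists>q\<in>(\<lambda>p y. p (?g y)) ` seminorms N.
          \<forall>f\<in>h ` carrier N. q f = (SUP x\<in>S. cmod (B (?g f) x))"
        using h(2) by (intro bexI[of _ "\<lambda>y. q (?g y)"]) simp_all
    qed
    subgoal using strong_dual_lact[OF B] h(2) by simp
    subgoal using strong_dual_ract[OF B] h(2) by simp
    done
qed

text \<open>Undoes the embedding \<open>i\<close> on level 0, so that the first dual is paired with
  the algebra itself and not with its copy.\<close>

lemma strong_dual_transport_left: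
  assumes B: "strong_dual (transport h M) N B" and M: "locally_convex_bimodule M"
    and h: "Vector_Spaces.linear scaleC scaleC h" "inj_on h (carrier M)"
  shows "strong_dual M N (\<lambda>f x. B f (h x))"
proof -
  note lc = locally_convex_bimoduleD[OF M] and tr = transport_locally_convex[OF h lc(1)]
  let ?g = "inv_into (carrier M) h"
  have bd: "bounded_subset M S \<Longrightarrow> bounded_subset (transport h M) (h ` S)" for S
    by (rule continuous_linear_bounded_image[OF lc(1) tr(1,2)])
  have bd': "bounded_subset (transport h M) S \<Longrightarrow> bounded_subset M (?g ` S)" for S
    by (rule continuous_linear_bounded_image[OF tr(1) lc(1) tr(3)])
  show ?thesis
    unfolding strong_dual_def
    apply (intro conjI)
    subgoal by (rule strong_dual_subspace[OF B])
    subgoal using strong_dual_linear[OF B] by (simp add: transport_simps)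
    subgoal using continuous_linear_compose[OF tr(2) strong_dual_continuous[OF B]] by simp
    subgoal
    proof (intro allI impI)
      fix g assume "continuous_linear M scalar_bimodule g"
      from continuous_linear_compose[OF tr(3) this]
      obtain f where "f \<in> carrier N" "\<And>y. y \<in> carrier (transport h M) \<Longrightarrow> B f y = g (?g y)"
        by (rule strong_dual_represent[OF B]) blast
      then show "\<exists>f\<in>carrier N. \<forall>x\<in>carrier M. B f (h x) = g x"
        using h(2) by (intro bexI[of _ f]) (simp_all add: transport_simps)
    qed
    subgoal
    proof (intro ballI impI)
      fix f assume f: "f \<in> carrier N" "\<forall>x\<in>carrier M. B f (h x) = 0"
      show "f = 0"
      proof (rule strong_dual_eqI[OF B f(1) complex_vector.subspace_0[OF strong_dual_subspace[OF B]]])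
        fix y assume y: "y \<in> carrier (transport h M)"
        have "B 0 y = 0"
          using linear_on_zero[OF strong_dual_linear[OF B y]
              complex_vector.subspace_0[OF strong_dual_subspace[OF B]]] .
        then show "B f y = B 0 y" using f(2) y by (auto simp: transport_simps)
      qed
    qed
    subgoal
    proof
      fix q assume "q \<in> seminorms N"
      then obtain S where S: "bounded_subset (transport h M) S" "S \<noteq> {}"
          "\<And>f. f \<in> carrier N \<Longrightarrow> q f = (SUP x\<in>S. cmod (B f x))"
        by (rule strong_dual_seminorm[OF B]) blast
      have "h (?g y) = y" if "y \<in> S" for y
        using S(1) that by (auto simp: bounded_subset_def transport_simps intro: f_inv_into_f)
      then have "(SUP y\<in>?g ` S. cmod (B f (h y))) = (SUP x\<in>S. cmod (B f x))" for f
        unfolding image_image by (intro SUP_cong) simp_all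
      then show "\<exists>S. bounded_subset M S \<and> S \<noteq> {} \<and>
          (\<forall>f\<in>carrier N. q f = (SUP x\<in>S. cmod (B f (h x))))"
        using S bd'[OF S(1)] by (intro exI[of _ "?g ` S"]) simp
    qed
    subgoal
    proof (intro allI impI)
      fix S assume S: "bounded_subset M S \<and> S \<noteq> {}"
      obtain q where "q \<in> seminorms N" "\<And>f. f \<in> carrier N \<Longrightarrow> q f = (SUP x\<in>h ` S. cmod (B f x))"
        by (rule strong_dual_bounded[OF B bd]) (use S in auto)
      then show "\<exists>q\<in>seminorms N. \<forall>f\<in>carrier N. q f = (SUP x\<in>S. cmod (B f (h x)))"
        by (intro bexI[of _ q]) (simp_all add: image_image)
    qed
    subgoal using strong_dual_lact[OF B] h(2) by (simp add: transport_simps)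
    subgoal using strong_dual_ract[OF B] h(2) by (simp add: transport_simps)
    done
qed

text \<open>The two claims support each other: duality between levels \<open>k\<close> and
  \<open>Suc k\<close> makes level \<open>Suc k\<close> a locally convex bimodule, and this is what
  the next duality requires.\<close>

lemma iterated_dual_strong_dual:
  assumes u: "dual_universe i c n" and M: "locally_convex_bimodule M" and k: "k < n"
  shows "strong_dual (iterated_dual i c M k) (iterated_dual i c M (Suc k))
      (inv_into (carrier (dual_bimodule (iterated_dual i c M k))) (c k)) \<and>
    locally_convex_bimodule (iterated_dual i c M k)"
  using k
proof (induction k)
  case 0
  have i: "Vector_Spaces.linear scaleC scaleC i" "inj_on i (carrier M)"
    using u by (auto simp: dual_universe_def intro: inj_on_subset)
  have lc: "locally_convex_bimodule (iterated_dual i c M 0)"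
    using transport_locally_convex_bimodule[OF i M] by simp
  have "Vector_Spaces.linear scaleC scaleC (c 0)" using u 0 by (simp add: dual_universe_def)
  from strong_dual_transport_right[OF strong_dual_dual_bimodule[OF lc] this inj_on_carrier_dual[OF u 0]]
  show ?case using lc by simp
next
  case (Suc k)
  then have lc: "locally_convex_bimodule (iterated_dual i c M (Suc k))"
    using locally_convex_bimodule_strong_dual by fastforce
  have "Vector_Spaces.linear scaleC scaleC (c (Suc k))" using u Suc.prems by (simp add: dual_universe_def)
  from strong_dual_transport_right[OF strong_dual_dual_bimodule[OF lc] this
      inj_on_carrier_dual[OF u Suc.prems]]
  show ?case using lc by simp
qed

lemma first_dual_strong_dual:
  assumes u: "dual_universe i c n" and M: "locally_convex_bimodule M" and n: "0 < n"
  obtains B where "strong_dual M (iterated_dual i c M 1) B"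
proof -
  have i: "Vector_Spaces.linear scaleC scaleC i" "inj_on i (carrier M)"
    using u by (auto simp: dual_universe_def intro: inj_on_subset)
  show ?thesis
    using iterated_dual_strong_dual[OF u M n] strong_dual_transport_left[OF _ M i]
    by (intro that) auto
qed

section \<open>Splitting off the unit in the iterated duals\<close>

text \<open>\<open>N = s(M) \<oplus> \<complex>E\<close> with coordinates \<open>r\<close> and \<open>\<sigma>\<close>; on level \<open>k\<close>, \<open>M\<close> is the \<open>k\<close>-th dual of the
  algebra and \<open>N\<close> that of its unitization.\<close>

definition unitization_split ::
  "('a, 'x::complex_vector) bimodule \<Rightarrow> ('b, 'y::complex_vector) bimodule \<Rightarrow>
   ('y \<Rightarrow> 'x) \<Rightarrow> ('x \<Rightarrow> 'y) \<Rightarrow> ('y \<Rightarrow> complex) \<Rightarrow> 'y \<Rightarrow> bool" where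
  "unitization_split M N r s \<sigma> E \<longleftrightarrow>
     continuous_linear N M r \<and> continuous_linear M N s \<and> continuous_linear N scalar_bimodule \<sigma> \<and>
     E \<in> carrier N \<and> r E = 0 \<and> \<sigma> E = 1 \<and> (\<forall>x\<in>carrier M. r (s x) = x \<and> \<sigma> (s x) = 0) \<and>
     (\<forall>y\<in>carrier N. y = s (r y) + \<sigma> y *\<^sub>C E)"

text \<open>On even levels \<open>P\<close> is the canonical embedding of the algebra and \<open>Q = 0\<close>; on odd levels
  \<open>P = 0\<close> and \<open>Q\<close> is the evaluation at canonically embedded elements. The two cases are kept in one
  formula because duality exchanges \<open>P\<close> and \<open>Q\<close>.\<close>

definition unitization_action ::
  "('a, 'x::complex_vector) bimodule \<Rightarrow> ('a unitization, 'y::complex_vector) bimodule \<Rightarrow>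
   ('y \<Rightarrow> 'x) \<Rightarrow> ('y \<Rightarrow> complex) \<Rightarrow> ('a \<Rightarrow> 'x) \<Rightarrow> ('x \<Rightarrow> 'a \<Rightarrow> complex) \<Rightarrow> bool" where
  "unitization_action M N r \<sigma> P Q \<longleftrightarrow> (\<forall>u. \<forall>y\<in>carrier N.
     r (lact N u y) =
       lact M (alg_part u) (r y) + scalar_part u *\<^sub>C r y + \<sigma> y *\<^sub>C P (alg_part u) \<and>
     \<sigma> (lact N u y) = scalar_part u * \<sigma> y + Q (r y) (alg_part u) \<and>
     r (ract N y u) =
       ract M (r y) (alg_part u) + scalar_part u *\<^sub>C r y + \<sigma> y *\<^sub>C P (alg_part u) \<and>
     \<sigma> (ract N y u) = scalar_part u * \<sigma> y + Q (r y) (alg_part u))"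

text \<open>Preservation of bounded sets is all that duality gives directly for the canonical embedding; its
  continuity is recovered, where needed, from \<open>bounded_functional_continuous\<close> below.\<close>

definition bounded_bimodule_map ::
  "(nat \<Rightarrow> 'a::complex_algebra \<Rightarrow> real) \<Rightarrow> ('a, 'x::complex_vector) bimodule \<Rightarrow>
   ('a \<Rightarrow> 'x) \<Rightarrow> bool" where
  "bounded_bimodule_map p M P \<longleftrightarrow> linear_on UNIV P \<and> (\<forall>a. P a \<in> carrier M) \<and>
     (\<forall>S. bounded_subset (self_bimodule p) S \<longrightarrow> bounded_subset M (P ` S)) \<and>
     (\<forall>a b. P (a * b) = lact M a (P b)) \<and> (\<forall>a b. P (a * b) = ract M (P a) b)"

text \<open>The dual notion to \<open>bounded_bimodule_map\<close>. The estimate, uniform over a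
  bounded set \<open>S\<close>, is continuity of \<open>f \<mapsto> Q f\<close> for uniform
  convergence on bounded sets; the last two clauses say that this map respects the actions, those on
  functionals being \<open>(a f)(b) = f(b a)\<close> and \<open>(f a)(b) = f(a b)\<close>.\<close>

definition bounded_balanced_pairing ::
  "(nat \<Rightarrow> 'a::complex_algebra \<Rightarrow> real) \<Rightarrow> ('a, 'x::complex_vector) bimodule \<Rightarrow>
   ('x \<Rightarrow> 'a \<Rightarrow> complex) \<Rightarrow> bool" where
  "bounded_balanced_pairing p M Q \<longleftrightarrow>
     (\<forall>a. linear_on (carrier M) (\<lambda>f. Q f a)) \<and> (\<forall>f\<in>carrier M. linear_on UNIV (Q f)) \<and>
     (\<forall>S. bounded_subset (self_bimodule p) S \<longrightarrow>
        (\<exists>q\<in>seminorms M. \<exists>C. \<forall>f\<in>carrier M. \<forall>a\<in>S. cmod (Q f a) \<le> C * q f)) \<and>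
     (\<forall>f\<in>carrier M. \<forall>a b. Q (lact M a f) b = Q f (b * a)) \<and>
     (\<forall>f\<in>carrier M. \<forall>a b. Q (ract M f a) b = Q f (a * b))"

lemma unitization_splitD:
  assumes "unitization_split M N r s \<sigma> E"
  shows "continuous_linear N M r" "continuous_linear M N s" "continuous_linear N scalar_bimodule \<sigma>"
    "E \<in> carrier N" "r E = 0" "\<sigma> E = 1" "\<And>x. x \<in> carrier M \<Longrightarrow> r (s x) = x"
    "\<And>x. x \<in> carrier M \<Longrightarrow> \<sigma> (s x) = 0" "\<And>y. y \<in> carrier N \<Longrightarrow> s (r y) + \<sigma> y *\<^sub>C E = y"
    "\<And>x. x \<in> carrier M \<Longrightarrow> s x \<in> carrier N" "\<And>y. y \<in> carrier N \<Longrightarrow> r y \<in> carrier M"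
  using assms continuous_linear_mem[of M N s] continuous_linear_mem[of N M r]
  unfolding unitization_split_def by auto

lemma unitization_split_eqI:
  assumes "unitization_split M N r s \<sigma> E" "x \<in> carrier N" "y \<in> carrier N" "r x = r y" "\<sigma> x = \<sigma> y"
  shows "x = y"
  using unitization_splitD(9)[OF assms(1)] assms(2-) by metis

lemma unitization_actionD:
  assumes "unitization_action M N r \<sigma> P Q" "y \<in> carrier N"
  shows "r (lact N u y) =
       lact M (alg_part u) (r y) + scalar_part u *\<^sub>C r y + \<sigma> y *\<^sub>C P (alg_part u)"
    "\<sigma> (lact N u y) = scalar_part u * \<sigma> y + Q (r y) (alg_part u)"
    "r (ract N y u) =
       ract M (r y) (alg_part u) + scalar_part u *\<^sub>C r y + \<sigma> y *\<^sub>C P (alg_part u)"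
    "\<sigma> (ract N y u) = scalar_part u * \<sigma> y + Q (r y) (alg_part u)"
  using assms unfolding unitization_action_def by blast+

lemma bounded_bimodule_mapD:
  assumes "bounded_bimodule_map p M P"
  shows "linear_on UNIV P" "P a \<in> carrier M"
    "bounded_subset (self_bimodule p) S \<Longrightarrow> bounded_subset M (P ` S)"
    "P (a * b) = lact M a (P b)" "P (a * b) = ract M (P a) b"
  using assms unfolding bounded_bimodule_map_def by blast+

lemma bounded_balanced_pairingD:
  assumes "bounded_balanced_pairing p M Q"
  shows "linear_on (carrier M) (\<lambda>f. Q f a)" "f \<in> carrier M \<Longrightarrow> linear_on UNIV (Q f)"
    "f \<in> carrier M \<Longrightarrow> Q (lact M a f) b = Q f (b * a)"
    "f \<in> carrier M \<Longrightarrow> Q (ract M f a) b = Q f (a * b)"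
  using assms unfolding bounded_balanced_pairing_def by blast+

lemma bounded_balanced_pairing_bound:
  assumes "bounded_balanced_pairing p M Q" "bounded_subset (self_bimodule p) S"
  obtains q C where "q \<in> seminorms M" "\<And>f a. f \<in> carrier M \<Longrightarrow> a \<in> S \<Longrightarrow> cmod (Q f a) \<le> C * q f"
  using assms unfolding bounded_balanced_pairing_def by meson

section \<open>Passage of the splitting and of the actions from a level to its dual\<close>

lemma continuous_functional_scalarI:
  assumes "locally_convex M" "linear_on (carrier M) g" "q \<in> seminorms M"
    "\<And>x. x \<in> carrier M \<Longrightarrow> cmod (g x) \<le> C * q x"
  shows "continuous_linear M scalar_bimodule g"
  by (rule continuous_linearI) (use assms in auto)

text \<open>The singleton \<open>{x}\<close> is bounded, so \<open>f \<mapsto> cmod (B f x)\<close>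
  is itself one of the strong seminorms on the carrier.\<close>

lemma evaluation_continuous:
  assumes B: "strong_dual M N B" and M: "locally_convex M" and x: "x \<in> carrier M"
  shows "continuous_linear N scalar_bimodule (\<lambda>f. B f x)"
proof -
  obtain q where q: "q \<in> seminorms N" "\<And>f. f \<in> carrier N \<Longrightarrow> q f = (SUP x\<in>{x}. cmod (B f x))"
    by (rule strong_dual_bounded[OF B, of "{x}"]) (use x in \<open>auto simp: bounded_subset_def\<close>)
  show ?thesis
    by (rule continuous_functional_scalarI[OF locally_convex_strong_dual[OF B M]
          strong_dual_linear[OF B x] q(1), of 1]) (simp add: q(2))
qed

text \<open>The coordinates dualize crosswise: \<open>r'\<close> is the adjoint of \<open>s\<close>,
  \<open>s'\<close> the adjoint of \<open>r\<close>, \<open>E'\<close> represents the functional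
  \<open>\<sigma>\<close>, and \<open>\<sigma>'\<close> is evaluation at \<open>E\<close>.\<close>

lemma unitization_split_dual:
  assumes sp: "unitization_split M N r s \<sigma> E"
    and B: "strong_dual M M' B" and C: "strong_dual N N' C"
    and M: "locally_convex M" and N: "locally_convex N"
  obtains r' s' \<sigma>' E' where "unitization_split M' N' r' s' \<sigma>' E'"
    "\<And>f x. f \<in> carrier N' \<Longrightarrow> x \<in> carrier M \<Longrightarrow> B (r' f) x = C f (s x)"
    "\<And>f. f \<in> carrier N' \<Longrightarrow> \<sigma>' f = C f E"
proof -
  note sp = unitization_splitD[OF sp]
  have SN: "complex_vector.subspace (carrier N)" using N by (simp add: locally_convex_def)
  obtain r' where r': "continuous_linear N' M' r'"
      "\<And>f x. f \<in> carrier N' \<Longrightarrow> x \<in> carrier M \<Longrightarrow> B (r' f) x = C f (s x)"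
    by (rule adjoint_continuous_linear[OF B C M N sp(2)]) blast
  obtain s' where s': "continuous_linear M' N' s'"
      "\<And>f x. f \<in> carrier M' \<Longrightarrow> x \<in> carrier N \<Longrightarrow> C (s' f) x = B f (r x)"
    by (rule adjoint_continuous_linear[OF C B N M sp(1)]) blast
  obtain E' where E': "E' \<in> carrier N'" "\<And>y. y \<in> carrier N \<Longrightarrow> C E' y = \<sigma> y"
    by (rule strong_dual_represent[OF C sp(3)]) blast
  have r'_mem: "r' f \<in> carrier M'" if "f \<in> carrier N'" for f
    by (rule continuous_linear_mem[OF r'(1) that])
  have s'_mem: "s' f \<in> carrier N'" if "f \<in> carrier M'" for f
    by (rule continuous_linear_mem[OF s'(1) that])
  have r'_E': "r' E' = 0"
  proof (rule strong_dual_eqI[OF B r'_mem[OF E'(1)] complex_vector.subspace_0[OF strong_dual_subspace[OF B]]])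
    fix x assume x: "x \<in> carrier M"
    show "B (r' E') x = B 0 x"
      using linear_on_zero[OF strong_dual_linear[OF B x]
          complex_vector.subspace_0[OF strong_dual_subspace[OF B]]]
      by (simp add: r'(2) E' x sp)
  qed
  have r's': "r' (s' f) = f" if f: "f \<in> carrier M'" for f
    by (rule strong_dual_eqI[OF B r'_mem[OF s'_mem[OF f]] f])
      (simp add: r'(2) s'(2) s'_mem f sp)
  have \<sigma>'s': "C (s' f) E = 0" if f: "f \<in> carrier M'" for f
    using linear_on_zero[OF continuous_linear_linear[OF strong_dual_continuous[OF B f]]] M
    by (simp add: s'(2) f sp locally_convex_def complex_vector.subspace_0)
  have split: "f = s' (r' f) + C f E *\<^sub>C E'" if f: "f \<in> carrier N'" for f
  proof (rule strong_dual_eqI[OF C f])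
    have mem: "s' (r' f) \<in> carrier N'" "C f E *\<^sub>C E' \<in> carrier N'"
      using s'_mem r'_mem f complex_vector.subspace_scale[OF strong_dual_subspace[OF C] E'(1)]
      by auto
    then show "s' (r' f) + C f E *\<^sub>C E' \<in> carrier N'"
      by (rule complex_vector.subspace_add[OF strong_dual_subspace[OF C]])
    fix y assume y: "y \<in> carrier N"
    have "C (s' (r' f) + C f E *\<^sub>C E') y = C f (s (r y)) + C f E * \<sigma> y"
      using linear_on_add[OF strong_dual_linear[OF C y] mem]
        linear_on_scale[OF strong_dual_linear[OF C y] E'(1)]
      by (simp add: s'(2) r'(2) r'_mem f y E'(2) sp scaleC_complex_def)
    also have "\<dots> = C f (s (r y) + \<sigma> y *\<^sub>C E)"
      using linear_on_add[OF continuous_linear_linear[OF strong_dual_continuous[OF C f]]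
          sp(10)[OF sp(11)[OF y]] complex_vector.subspace_scale[OF SN sp(4)], of "\<sigma> y"]
        linear_on_scale[OF continuous_linear_linear[OF strong_dual_continuous[OF C f]] sp(4), of "\<sigma> y"]
      by (simp add: scaleC_complex_def)
    finally show "C f y = C (s' (r' f) + C f E *\<^sub>C E') y" by (simp add: sp(9)[OF y])
  qed
  have "unitization_split M' N' r' s' (\<lambda>f. C f E) E'"
    unfolding unitization_split_def
    using r'(1) s'(1) evaluation_continuous[OF C N sp(4)] E'(1) r'_E' r's' \<sigma>'s' split
      E'(2)[OF sp(4)] sp(6) by auto
  then show ?thesis using r'(2) by (rule that) auto
qed

text \<open>\<open>P'\<close> and \<open>Q'\<close> arise by exchange: \<open>P' a\<close>
  represents the functional \<open>Q _ a\<close>, and \<open>Q' f a\<close> is the pairing of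
  \<open>f\<close> with \<open>P a\<close>. The rest is a comparison of coordinates in the
  decomposed pairing.\<close>

lemma unitization_action_dual:
  fixes M :: "('a::complex_algebra, 'x::complex_vector) bimodule"
  assumes sp: "unitization_split M N r s \<sigma> E" and act: "unitization_action M N r \<sigma> P Q"
    and B: "strong_dual M M' B" and C: "strong_dual N N' C"
    and M: "locally_convex_bimodule M" and N: "locally_convex_bimodule N"
    and sp': "unitization_split M' N' r' s' \<sigma>' E'"
    and r': "\<And>f x. f \<in> carrier N' \<Longrightarrow> x \<in> carrier M \<Longrightarrow> B (r' f) x = C f (s x)"
    and \<sigma>': "\<And>f. f \<in> carrier N' \<Longrightarrow> \<sigma>' f = C f E"
    and P: "\<And>a. P a \<in> carrier M" and P': "\<And>a. P' a \<in> carrier M'"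
    and Q: "\<And>a. linear_on (carrier M) (\<lambda>x. Q x a)"
    and BP: "\<And>x a. x \<in> carrier M \<Longrightarrow> B (P' a) x = Q x a"
    and BQ: "\<And>f a. f \<in> carrier M' \<Longrightarrow> Q' f a = B f (P a)"
  shows "unitization_action M' N' r' \<sigma>' P' Q'"
proof -
  note lM = locally_convex_bimoduleD[OF M] and lN = locally_convex_bimoduleD[OF N]
  note spD = unitization_splitD[OF sp] and spD' = unitization_splitD[OF sp']
  note actD = unitization_actionD[OF act]
  note subM' = strong_dual_subspace[OF B]
  have M0: "0 \<in> carrier M" by (rule complex_vector.subspace_0[OF lM(2)])
  \<comment> \<open>In the two splittings the pairing is the orthogonal sum of the pairing
    \<open>B\<close> and the product of the scalar coordinates.\<close>
  have pair: "C f y = B (r' f) (r y) + \<sigma> y * \<sigma>' f" if f: "f \<in> carrier N'" and y: "y \<in> carrier N" for f y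
  proof -
    note lin = continuous_linear_linear[OF strong_dual_continuous[OF C f]]
    have "C f y = C f (s (r y) + \<sigma> y *\<^sub>C E)" by (simp add: spD(9)[OF y])
    also have "\<dots> = C f (s (r y)) + \<sigma> y * C f E"
      using linear_on_add[OF lin spD(10)[OF spD(11)[OF y]] complex_vector.subspace_scale[OF lN(2) spD(4)]]
        linear_on_scale[OF lin spD(4)] by (simp add: scaleC_complex_def)
    finally show ?thesis using r'[OF f spD(11)[OF y]] \<sigma>'[OF f] by simp
  qed
  have zero: "lact M a 0 = 0" "ract M 0 a = 0" "Q 0 a = 0" for a
    using linear_on_zero[OF continuous_linear_linear[OF lM(3)] M0]
      linear_on_zero[OF continuous_linear_linear[OF lM(4)] M0] linear_on_zero[OF Q M0] by auto
  \<comment> \<open>Treats both sides at once: \<open>g\<close> is \<open>f\<close> acted on by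
    \<open>u\<close>, \<open>h\<close> is \<open>r' f\<close> acted on by
    \<open>a = alg_part u\<close>, and \<open>z = scalar_part u\<close>. By duality
    \<open>y x\<close> is the opposite action of \<open>u\<close> on \<open>s x\<close>, and
    \<open>w x\<close> that of \<open>a\<close> on \<open>x\<close>.\<close>
  have r_eq: "r' g = h + z *\<^sub>C r' f + \<sigma>' f *\<^sub>C P' a"
    if f: "f \<in> carrier N'" and g: "g \<in> carrier N'" and h: "h \<in> carrier M'"
      and y: "\<And>x. x \<in> carrier M \<Longrightarrow> y x \<in> carrier N \<and> C g (s x) = C f (y x) \<and>
        r (y x) = w x + z *\<^sub>C x \<and> w x \<in> carrier M \<and> \<sigma> (y x) = Q x a \<and> B h x = B (r' f) (w x)"
    for f g h a z w y
  proof (rule strong_dual_eqI[OF B spD'(11)[OF g]])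
    have mem: "z *\<^sub>C r' f \<in> carrier M'" "\<sigma>' f *\<^sub>C P' a \<in> carrier M'"
      using complex_vector.subspace_scale[OF subM'] spD'(11)[OF f] P' by auto
    have mem2: "h + z *\<^sub>C r' f \<in> carrier M'" by (rule complex_vector.subspace_add[OF subM' h mem(1)])
    then show "h + z *\<^sub>C r' f + \<sigma>' f *\<^sub>C P' a \<in> carrier M'"
      using mem(2) by (rule complex_vector.subspace_add[OF subM'])
    fix x assume x: "x \<in> carrier M"
    note linB = strong_dual_linear[OF B x]
    note lin = continuous_linear_linear[OF strong_dual_continuous[OF B spD'(11)[OF f]]]
    have "B (r' g) x = B (r' f) (w x + z *\<^sub>C x) + Q x a * \<sigma>' f"
      using y[OF x] pair[OF f, of "y x"] r'[OF g x] by simp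
    also have "\<dots> = B (r' f) (w x) + z * B (r' f) x + Q x a * \<sigma>' f"
      using linear_on_add[OF lin _ complex_vector.subspace_scale[OF lM(2) x]] y[OF x]
        linear_on_scale[OF lin x] by (simp add: scaleC_complex_def)
    also have "\<dots> = B (h + z *\<^sub>C r' f + \<sigma>' f *\<^sub>C P' a) x"
      using linear_on_add[OF linB mem2 mem(2)] linear_on_add[OF linB h mem(1)]
        linear_on_scale[OF linB spD'(11)[OF f]] linear_on_scale[OF linB P'] y[OF x] BP[OF x]
      by (simp add: scaleC_complex_def)
    finally show "B (r' g) x = B (h + z *\<^sub>C r' f + \<sigma>' f *\<^sub>C P' a) x" .
  qed
  show ?thesis
    unfolding unitization_action_def
  proof (intro allI ballI conjI)
    fix u f assume f: "f \<in> carrier N'"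
    note Lf = strong_dual_lact[OF C f] and Rf = strong_dual_ract[OF C f]
    note LM = strong_dual_lact[OF B spD'(11)[OF f]] and RM = strong_dual_ract[OF B spD'(11)[OF f]]
    show "r' (lact N' u f) = lact M' (alg_part u) (r' f) + scalar_part u *\<^sub>C r' f +
        \<sigma>' f *\<^sub>C P' (alg_part u)"
      by (rule r_eq[OF f Lf(1) LM(1), where y = "\<lambda>x. ract N (s x) u"
            and w = "\<lambda>x. ract M x (alg_part u)"])
        (simp add: Lf(2) LM(2) spD lN(6) lM(6) actD complex_vector.scale_zero_left)
    show "r' (ract N' f u) = ract M' (r' f) (alg_part u) + scalar_part u *\<^sub>C r' f +
        \<sigma>' f *\<^sub>C P' (alg_part u)"
      by (rule r_eq[OF f Rf(1) RM(1), where y = "\<lambda>x. lact N u (s x)"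
            and w = "\<lambda>x. lact M (alg_part u) x"])
        (simp add: Rf(2) RM(2) spD lN(5) lM(5) actD complex_vector.scale_zero_left)
    \<comment> \<open>The left side is \<open>C f (ract N E u)\<close>. As \<open>r E = 0\<close>
      and \<open>\<sigma> E = 1\<close>, the element \<open>ract N E u\<close> has coordinates
      \<open>P (alg_part u)\<close> and \<open>scalar_part u\<close>.\<close>
    show "\<sigma>' (lact N' u f) = scalar_part u * \<sigma>' f + Q' (r' f) (alg_part u)"
      using pair[OF f lN(6)[OF spD(4)]]
      by (simp add: \<sigma>' Lf f spD actD zero BQ spD' complex_vector.scale_zero_right scaleC_one)
    show "\<sigma>' (ract N' f u) = scalar_part u * \<sigma>' f + Q' (r' f) (alg_part u)"
      using pair[OF f lN(5)[OF spD(4)]]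
      by (simp add: \<sigma>' Rf f spD actD zero BQ spD' complex_vector.scale_zero_right scaleC_one)
  qed
qed

lemma bounded_subset_self_insert:
  "bounded_subset (self_bimodule p) S \<Longrightarrow> bounded_subset (self_bimodule p) (insert a S)"
  by (auto simp: bounded_subset_def self_bimodule_def)

lemma bounded_balanced_pairing_continuous:
  assumes M: "locally_convex M" and Q: "bounded_balanced_pairing p M Q"
  shows "continuous_linear M scalar_bimodule (\<lambda>f. Q f a)"
proof -
  have "bounded_subset (self_bimodule p) {a}" by (simp add: bounded_subset_def self_bimodule_def)
  then obtain q C where "q \<in> seminorms M" "\<And>f. f \<in> carrier M \<Longrightarrow> cmod (Q f a) \<le> C * q f"
    by (rule bounded_balanced_pairing_bound[OF Q]) blast
  then show ?thesis
    by (rule continuous_functional_scalarI[OF M bounded_balanced_pairingD(1)[OF Q]])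
qed

text \<open>\<open>P\<close> sends a bounded set to a bounded set, over which the supremum is one of
  the strong seminorms of the dual; this is the uniform estimate.\<close>

lemma bounded_balanced_pairing_dual:
  assumes B: "strong_dual M M' B" and M: "locally_convex_bimodule M"
    and P: "bounded_bimodule_map p M P"
  shows "bounded_balanced_pairing p M' (\<lambda>f a. B f (P a))"
proof -
  note PD = bounded_bimodule_mapD[OF P]
  have "linear_on UNIV (\<lambda>a. B f (P a))" if "f \<in> carrier M'" for f
    using linear_on_compose[OF PD(1) continuous_linear_linear[OF strong_dual_continuous[OF B that]]] PD(2)
    by (simp add: comp_def image_subset_iff)
  moreover have "\<exists>q\<in>seminorms M'. \<exists>C. \<forall>f\<in>carrier M'. \<forall>a\<in>S. cmod (B f (P a)) \<le> C * q f"
    if S: "bounded_subset (self_bimodule p) S" for S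
  proof -
    \<comment> \<open>\<open>0\<close> is inserted because the seminorms of the dual come from nonempty bounded sets.\<close>
    have bd: "bounded_subset M (P ` insert 0 S)" by (rule PD(3)[OF bounded_subset_self_insert[OF S]])
    then obtain q where q: "q \<in> seminorms M'"
        "\<And>f. f \<in> carrier M' \<Longrightarrow> q f = (SUP x\<in>P ` insert 0 S. cmod (B f x))"
      by (rule strong_dual_bounded[OF B]) auto
    have "\<forall>f\<in>carrier M'. \<forall>a\<in>S. cmod (B f (P a)) \<le> 1 * q f"
      using SUP_cmod_le_seminorm[OF B locally_convex_bimoduleD(1)[OF M] _ bd] q(2) by auto
    then show ?thesis using q(1) by blast
  qed
  ultimately show ?thesis
    unfolding bounded_balanced_pairing_def
    using strong_dual_linear[OF B PD(2)] strong_dual_lact(2)[OF B _ PD(2)]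
      strong_dual_ract(2)[OF B _ PD(2)] PD(4,5)
    by auto
qed

text \<open>For \<open>a\<close> in a bounded set, \<open>Q _ a\<close> is dominated by a multiple
  of one seminorm \<open>q\<close> independent of \<open>a\<close>. Since \<open>q\<close> is
  bounded on each bounded \<open>T\<close>, the strong seminorm over \<open>T\<close> is bounded
  along all \<open>P' a\<close>.\<close>

lemma bounded_bimodule_map_dual:
  assumes B: "strong_dual M M' B" and M: "locally_convex_bimodule M"
    and Q: "bounded_balanced_pairing p M Q"
    and P': "\<And>a. P' a \<in> carrier M'" "\<And>x a. x \<in> carrier M \<Longrightarrow> B (P' a) x = Q x a"
  shows "bounded_bimodule_map p M' P'"
proof -
  note QD = bounded_balanced_pairingD[OF Q] and lM = locally_convex_bimoduleD[OF M]
  have lin: "linear_on UNIV P'"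
    by (rule strong_dual_linearI[OF B complex_vector.subspace_UNIV P'(1)]) (simp add: P'(2) QD(2))
  have bd: "bounded_subset M' (P' ` S)" if S: "bounded_subset (self_bimodule p) S" for S
    unfolding bounded_subset_def
  proof (intro conjI ballI)
    show "P' ` S \<subseteq> carrier M'" using P'(1) by auto
    fix t assume "t \<in> seminorms M'"
    then obtain T where T: "bounded_subset M T" "T \<noteq> {}"
        "\<And>f. f \<in> carrier M' \<Longrightarrow> t f = (SUP x\<in>T. cmod (B f x))"
      by (rule strong_dual_seminorm[OF B]) blast
    obtain q C where q: "q \<in> seminorms M" "\<And>f a. f \<in> carrier M \<Longrightarrow> a \<in> S \<Longrightarrow> cmod (Q f a) \<le> C * q f"
      by (rule bounded_balanced_pairing_bound[OF Q S]) blast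
    obtain K where K: "\<And>x. x \<in> T \<Longrightarrow> q x \<le> K"
      using T(1) q(1) unfolding bounded_subset_def bdd_above_def by fast
    \<comment> \<open>The sign of \<open>C\<close> is unknown, and the absolute value allows
      \<open>q x\<close> to be replaced by its bound \<open>K\<close>.\<close>
    have "t (P' a) \<le> \<bar>C\<bar> * K" if a: "a \<in> S" for a
      unfolding T(3)[OF P'(1)]
    proof (rule cSUP_least[OF T(2)])
      fix x assume x: "x \<in> T"
      then have xM: "x \<in> carrier M" using T(1) by (auto simp: bounded_subset_def)
      have "seminorm_on (carrier M) q" using lM(1) q(1) by (simp add: locally_convex_def)
      then have "0 \<le> q x" using lM(2) xM by (rule seminorm_on_nonneg)
      have "cmod (B (P' a) x) \<le> C * q x" using q(2)[OF xM a] P'(2)[OF xM] by simp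
      also have "\<dots> \<le> \<bar>C\<bar> * q x" using \<open>0 \<le> q x\<close> by (intro mult_right_mono) auto
      also have "\<dots> \<le> \<bar>C\<bar> * K" using K[OF x] by (intro mult_left_mono) auto
      finally show "cmod (B (P' a) x) \<le> \<bar>C\<bar> * K" .
    qed
    then show "bdd_above (t ` P' ` S)" unfolding image_image by (rule bdd_aboveI2)
  qed
  have "P' (a * b) = lact M' a (P' b)" for a b
    by (rule strong_dual_eqI[OF B P'(1) strong_dual_lact(1)[OF B P'(1)]])
      (simp add: strong_dual_lact(2)[OF B P'(1)] P'(2) lM(6) QD(4))
  moreover have "P' (a * b) = ract M' (P' a) b" for a b
    by (rule strong_dual_eqI[OF B P'(1) strong_dual_ract(1)[OF B P'(1)]])
      (simp add: strong_dual_ract(2)[OF B P'(1)] P'(2) lM(5) QD(3))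
  ultimately show ?thesis
    unfolding bounded_bimodule_map_def using lin bd P'(1) by blast
qed

text \<open>The invariant of the induction over levels. The vanishing of \<open>P\<close> or of
  \<open>Q\<close> is kept outside, because it alternates with the parity of the level.\<close>

definition unitization_level where
  "unitization_level p M N r s \<sigma> E P Q \<longleftrightarrow>
     locally_convex_bimodule M \<and> locally_convex_bimodule N \<and>
     unitization_split M N r s \<sigma> E \<and> unitization_action M N r \<sigma> P Q \<and>
     bounded_bimodule_map p M P \<and> bounded_balanced_pairing p M Q"

text \<open>The two implications express the change of parity: \<open>Q'\<close> is built from
  \<open>P\<close> and \<open>P'\<close> from \<open>Q\<close>, so whichever vanishes makes the
  other vanish one level up.\<close>

lemma unitization_level_dual:
  assumes "unitization_level p M N r s \<sigma> E P Q"
    and B: "strong_dual M M' B" and C: "strong_dual N N' C"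
  shows "\<exists>r' s' \<sigma>' E' P' Q'. unitization_level p M' N' r' s' \<sigma>' E' P' Q' \<and>
    ((\<forall>a. P a = 0) \<longrightarrow> (\<forall>f\<in>carrier M'. \<forall>a. Q' f a = 0)) \<and>
    ((\<forall>f\<in>carrier M. \<forall>a. Q f a = 0) \<longrightarrow> (\<forall>a. P' a = 0))"
proof -
  have M: "locally_convex_bimodule M" and N: "locally_convex_bimodule N"
    and sp: "unitization_split M N r s \<sigma> E" and act: "unitization_action M N r \<sigma> P Q"
    and P: "bounded_bimodule_map p M P" and Q: "bounded_balanced_pairing p M Q"
    using assms(1) by (simp_all add: unitization_level_def)
  note lM = locally_convex_bimoduleD[OF M] and lN = locally_convex_bimoduleD[OF N]
  obtain r' s' \<sigma>' E' where sp': "unitization_split M' N' r' s' \<sigma>' E'"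
      "\<And>f x. f \<in> carrier N' \<Longrightarrow> x \<in> carrier M \<Longrightarrow> B (r' f) x = C f (s x)"
      "\<And>f. f \<in> carrier N' \<Longrightarrow> \<sigma>' f = C f E"
    by (rule unitization_split_dual[OF sp B C lM(1) lN(1)]) blast
  have "\<exists>g. g \<in> carrier M' \<and> (\<forall>x\<in>carrier M. B g x = Q x a)" for a
    using strong_dual_represent[OF B bounded_balanced_pairing_continuous[OF lM(1) Q]] by metis
  then obtain P' where P': "\<And>a. P' a \<in> carrier M'" "\<And>x a. x \<in> carrier M \<Longrightarrow> B (P' a) x = Q x a"
    by metis
  define Q' where "Q' = (\<lambda>f a. B f (P a))"
  have "unitization_action M' N' r' \<sigma>' P' Q'"
    by (rule unitization_action_dual[OF sp act B C M N sp' bounded_bimodule_mapD(2)[OF P] P'(1)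
          bounded_balanced_pairingD(1)[OF Q] P'(2)]) (simp_all add: Q'_def)
  moreover have "bounded_bimodule_map p M' P'" by (rule bounded_bimodule_map_dual[OF B M Q P'])
  moreover have "bounded_balanced_pairing p M' Q'"
    unfolding Q'_def by (rule bounded_balanced_pairing_dual[OF B M P])
  ultimately have "unitization_level p M' N' r' s' \<sigma>' E' P' Q'"
    using sp'(1) locally_convex_bimodule_strong_dual[OF B M] locally_convex_bimodule_strong_dual[OF C N]
    by (simp add: unitization_level_def)
  moreover have "Q' f a = 0" if "\<forall>a. P a = 0" "f \<in> carrier M'" for f a
    using linear_on_zero[OF continuous_linear_linear[OF strong_dual_continuous[OF B that(2)]]
        complex_vector.subspace_0[OF lM(2)]] that(1) by (simp add: Q'_def)
  moreover have "P' a = 0" if "\<forall>f\<in>carrier M. \<forall>a. Q f a = 0" for a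
  proof (rule strong_dual_eqI[OF B P'(1) complex_vector.subspace_0[OF strong_dual_subspace[OF B]]])
    fix x assume x: "x \<in> carrier M"
    show "B (P' a) x = B 0 x"
      using linear_on_zero[OF strong_dual_linear[OF B x]
          complex_vector.subspace_0[OF strong_dual_subspace[OF B]]] that x
      by (simp add: P'(2))
  qed
  ultimately have "unitization_level p M' N' r' s' \<sigma>' E' P' Q' \<and>
    ((\<forall>a. P a = 0) \<longrightarrow> (\<forall>f\<in>carrier M'. \<forall>a. Q' f a = 0)) \<and>
    ((\<forall>f\<in>carrier M. \<forall>a. Q f a = 0) \<longrightarrow> (\<forall>a. P' a = 0))" by blast
  then show ?thesis by (intro exI)
qed

section \<open>The algebra as a bimodule over itself\<close>

lemma self_bimodule_simps [simp]:
  "carrier (self_bimodule p) = UNIV" "seminorms (self_bimodule p) = range p"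
  "lact (self_bimodule p) = (*)" "ract (self_bimodule p) = (*)"
  by (simp_all add: self_bimodule_def)

lemma self_bimodule_locally_convex:
  assumes "\<And>l. seminorm (p l)" "\<And>l x y. p l (x * y) \<le> p l x * p l y"
  shows "locally_convex_bimodule (self_bimodule p)"
proof -
  have lc: "locally_convex (self_bimodule p)"
    using assms(1) by (auto simp: locally_convex_def seminorm_on_def seminorm_def complex_vector.subspace_UNIV)
  have "continuous_linear (self_bimodule p) (self_bimodule p) ((*) b)" for b
  proof (rule continuous_linearI[OF lc lc])
    fix q assume "q \<in> seminorms (self_bimodule p)"
    then obtain l where "q = p l" by auto
    then have "q (b * x) \<le> p l b * p l x" for x using assms(2) by simp
    then show "\<exists>r\<in>seminorms (self_bimodule p). \<exists>C. \<forall>x\<in>carrier (self_bimodule p). q (b * x) \<le> C * r x"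
      by auto
  qed (simp_all add: linear_on_def distrib_left scaleC_mult_right)
  moreover have "continuous_linear (self_bimodule p) (self_bimodule p) (\<lambda>x. x * b)" for b
  proof (rule continuous_linearI[OF lc lc])
    fix q assume "q \<in> seminorms (self_bimodule p)"
    then obtain l where "q = p l" by auto
    then have "q (x * b) \<le> p l b * p l x" for x using assms(2)[of l x b] by (simp add: mult.commute)
    then show "\<exists>r\<in>seminorms (self_bimodule p). \<exists>C. \<forall>x\<in>carrier (self_bimodule p). q (x * b) \<le> C * r x"
      by auto
  qed (simp_all add: linear_on_def distrib_right scaleC_mult_left)
  ultimately show ?thesis
    using lc unfolding locally_convex_bimodule_def
    by (simp add: linear_on_def distrib_left distrib_right scaleC_mult_left scaleC_mult_right)
qed

lemma unitization_simps [simp]: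
  "alg_part (x + y) = alg_part x + alg_part y" "scalar_part (x + y) = scalar_part x + scalar_part y"
  "alg_part (a *\<^sub>C x) = a *\<^sub>C alg_part x" "scalar_part (a *\<^sub>C x) = a * scalar_part x"
  "alg_part (x * y) = alg_part x * alg_part y + scalar_part y *\<^sub>C alg_part x + scalar_part x *\<^sub>C alg_part y"
  "scalar_part (x * y) = scalar_part x * scalar_part y"
  by (simp_all add: plus_unitization_def scaleC_unitization_def times_unitization_def)

lemma seminormD:
  assumes "seminorm p"
  shows "p (x + y) \<le> p x + p y" "p (a *\<^sub>C x) = cmod a * p x" "0 \<le> p x"
  using assms seminorm_on_nonneg[of UNIV p x]
  by (auto simp: seminorm_def seminorm_on_def complex_vector.subspace_UNIV)

lemma unitization_seminorms_seminorm:
  assumes "seminorm (p l)"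
  shows "seminorm (unitization_seminorms p l)"
  unfolding seminorm_def unitization_seminorms_def
proof (intro conjI allI)
  fix x y
  show "p l (alg_part (x + y)) + cmod (scalar_part (x + y)) \<le>
      p l (alg_part x) + cmod (scalar_part x) + (p l (alg_part y) + cmod (scalar_part y))"
    using seminormD(1)[OF assms, of "alg_part x" "alg_part y"]
      norm_triangle_ineq[of "scalar_part x" "scalar_part y"] by simp
qed (simp add: seminormD(2)[OF assms] norm_mult distrib_left)

lemma unitization_seminorms_mult:
  assumes s: "seminorm (p l)" and m: "\<And>x y. p l (x * y) \<le> p l x * p l y"
  shows "unitization_seminorms p l (x * y) \<le> unitization_seminorms p l x * unitization_seminorms p l y"
proof -
  let ?a = "alg_part x" and ?b = "alg_part y" and ?z = "scalar_part x" and ?w = "scalar_part y"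
  have "p l (?a * ?b + ?w *\<^sub>C ?a + ?z *\<^sub>C ?b) \<le> p l (?a * ?b) + p l (?w *\<^sub>C ?a) + p l (?z *\<^sub>C ?b)"
    using seminormD(1)[OF s, of "?a * ?b + ?w *\<^sub>C ?a" "?z *\<^sub>C ?b"]
      seminormD(1)[OF s, of "?a * ?b" "?w *\<^sub>C ?a"] by linarith
  also have "\<dots> \<le> p l ?a * p l ?b + cmod ?w * p l ?a + cmod ?z * p l ?b"
    using m[of ?a ?b] by (simp add: seminormD(2)[OF s])
  finally show ?thesis
    by (simp add: unitization_seminorms_def norm_mult algebra_simps)
qed

text \<open>Level 0, an even one: with \<open>P\<close> the identity and \<open>Q = 0\<close>,
  \<open>unitization_action\<close> is the product formula of the unitization.\<close>

lemma unitization_level_self: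
  assumes s: "\<And>l. seminorm (p l)" and m: "\<And>l x y. p l (x * y) \<le> p l x * p l y"
  shows "unitization_level p (self_bimodule p) (self_bimodule (unitization_seminorms p))
    alg_part (\<lambda>a. Unitization a 0) scalar_part (Unitization 0 1) (\<lambda>a. a) (\<lambda>_ _. 0)"
proof -
  let ?M = "self_bimodule p" and ?N = "self_bimodule (unitization_seminorms p)"
  have M: "locally_convex_bimodule ?M" using assms by (rule self_bimodule_locally_convex)
  have N: "locally_convex_bimodule ?N"
    using assms by (intro self_bimodule_locally_convex unitization_seminorms_seminorm unitization_seminorms_mult)
  note lM = locally_convex_bimoduleD(1)[OF M] and lN = locally_convex_bimoduleD(1)[OF N]
  have r: "continuous_linear ?N ?M alg_part"
  proof (rule continuous_linearI[OF lN lM])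
    fix q assume "q \<in> seminorms ?M"
    then obtain l where "q = p l" by auto
    then have "\<forall>x\<in>carrier ?N. q (alg_part x) \<le> 1 * unitization_seminorms p l x"
      by (simp add: unitization_seminorms_def)
    then show "\<exists>t\<in>seminorms ?N. \<exists>C. \<forall>x\<in>carrier ?N. q (alg_part x) \<le> C * t x"
      by fastforce
  qed (simp_all add: linear_on_def)
  have i: "continuous_linear ?M ?N (\<lambda>a. Unitization a 0)"
  proof (rule continuous_linearI[OF lM lN])
    fix q assume "q \<in> seminorms ?N"
    then obtain l where "q = unitization_seminorms p l" by auto
    then have "\<forall>x\<in>carrier ?M. q (Unitization x 0) \<le> 1 * p l x"
      by (simp add: unitization_seminorms_def)
    then show "\<exists>t\<in>seminorms ?M. \<exists>C. \<forall>x\<in>carrier ?M. q (Unitization x 0) \<le> C * t x"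
      by fastforce
  qed (simp_all add: linear_on_def unitization.expand)
  have sc: "continuous_linear ?N scalar_bimodule scalar_part"
    by (rule continuous_functional_scalarI[OF lN, of _ "unitization_seminorms p 0" 1])
      (auto simp: linear_on_def scaleC_complex_def unitization_seminorms_def seminormD(3)[OF s])
  have "unitization_split ?M ?N alg_part (\<lambda>a. Unitization a 0) scalar_part (Unitization 0 1)"
    unfolding unitization_split_def using r i sc
    by (auto intro!: unitization.expand simp: complex_vector.scale_zero_right)
  moreover have "unitization_action ?M ?N alg_part scalar_part (\<lambda>a. a) (\<lambda>_ _. 0)"
    by (simp add: unitization_action_def add_ac mult.commute)
  moreover have "bounded_bimodule_map p ?M (\<lambda>a. a)"
    by (simp add: bounded_bimodule_map_def linear_on_def)
  moreover have "bounded_balanced_pairing p ?M (\<lambda>_ _. 0)"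
  proof -
    have "\<exists>q\<in>range p. \<exists>C. \<forall>f. \<forall>a\<in>S. (0::real) \<le> C * q f" for S :: "'a set"
      by (intro bexI[of _ "p 0"] exI[of _ 0]) auto
    then show ?thesis
      by (simp add: bounded_balanced_pairing_def linear_on_def scaleC_complex_def)
  qed
  ultimately show ?thesis using M N by (simp add: unitization_level_def)
qed

text \<open>The index is shifted, so even \<open>k\<close> means the odd level \<open>Suc k\<close>,
  where \<open>P = 0\<close>. The induction starts at the first dual, dualizing the algebras
  themselves, since level 0 of \<open>iterated_dual\<close> is only a copy inside the universe
  type.\<close>

lemma unitization_level_iterated:
  fixes p :: "nat \<Rightarrow> 'a::complex_algebra \<Rightarrow> real"
  assumes s: "\<And>l. seminorm (p l)" and m: "\<And>l x y. p l (x * y) \<le> p l x * p l y"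
    and i: "dual_universe i c n" and j: "dual_universe j d n" and "k < n"
  shows "\<exists>r s \<sigma> E P Q. unitization_level p (iterated_dual i c (self_bimodule p) (Suc k))
      (iterated_dual j d (self_bimodule (unitization_seminorms p)) (Suc k)) r s \<sigma> E P Q \<and>
    (if even k then \<forall>a. P a = 0
     else \<forall>f\<in>carrier (iterated_dual i c (self_bimodule p) (Suc k)). \<forall>a. Q f a = 0)"
  using \<open>k < n\<close>
proof (induction k)
  case 0
  note base = unitization_level_self[of p, OF s m]
  have M: "locally_convex_bimodule (self_bimodule p)"
    and N: "locally_convex_bimodule (self_bimodule (unitization_seminorms p))"
    using base by (simp_all add: unitization_level_def)
  obtain B where B: "strong_dual (self_bimodule p) (iterated_dual i c (self_bimodule p) 1) B"
    by (rule first_dual_strong_dual[OF i M 0])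
  obtain C where C: "strong_dual (self_bimodule (unitization_seminorms p))
      (iterated_dual j d (self_bimodule (unitization_seminorms p)) 1) C"
    by (rule first_dual_strong_dual[OF j N 0])
  obtain r s \<sigma> E P Q where "unitization_level p (iterated_dual i c (self_bimodule p) 1)
      (iterated_dual j d (self_bimodule (unitization_seminorms p)) 1) r s \<sigma> E P Q \<and> (\<forall>a. P a = 0)"
    using unitization_level_dual[OF base B C] by blast
  then have "unitization_level p (iterated_dual i c (self_bimodule p) (Suc 0))
      (iterated_dual j d (self_bimodule (unitization_seminorms p)) (Suc 0)) r s \<sigma> E P Q \<and>
    (if even (0::nat) then \<forall>a. P a = 0
     else \<forall>f\<in>carrier (iterated_dual i c (self_bimodule p) (Suc 0)). \<forall>a. Q f a = 0)"
    by (simp del: iterated_dual.simps)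
  then show ?case by (intro exI)
next
  case (Suc k)
  note base = unitization_level_self[of p, OF s m]
  have M: "locally_convex_bimodule (self_bimodule p)"
    and N: "locally_convex_bimodule (self_bimodule (unitization_seminorms p))"
    using base by (simp_all add: unitization_level_def)
  obtain r s \<sigma> E P Q where lev: "unitization_level p (iterated_dual i c (self_bimodule p) (Suc k))
      (iterated_dual j d (self_bimodule (unitization_seminorms p)) (Suc k)) r s \<sigma> E P Q"
    and par: "if even k then \<forall>a. P a = 0
      else \<forall>f\<in>carrier (iterated_dual i c (self_bimodule p) (Suc k)). \<forall>a. Q f a = 0"
    using Suc by (auto simp del: iterated_dual.simps)
  show ?case
    using unitization_level_dual[OF lev conjunct1[OF iterated_dual_strong_dual[OF i M Suc.prems]]
        conjunct1[OF iterated_dual_strong_dual[OF j N Suc.prems]]] par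
    by (elim ex_forward) (simp del: iterated_dual.simps split: if_splits)
qed

section \<open>Derivations\<close>

lemma continuous_derivation_iff:
  "continuous_derivation p M D \<longleftrightarrow> continuous_linear (self_bimodule p) M D \<and>
     (\<forall>a b. D (a * b) = lact M a (D b) + ract M (D a) b)"
  using continuous_linear_mem[of "self_bimodule p" M D]
  by (auto simp: continuous_derivation_def continuous_linear_def linear_on_UNIV bimodule_topology_def)

text \<open>If \<open>\<bar>g x\<^sub>k\<bar> > k p\<^sub>k(x\<^sub>k)\<close> for every \<open>k\<close>, then rescaling to \<open>g y\<^sub>k = k\<close> gives
  \<open>p\<^sub>k(y\<^sub>k) \<le> 1\<close>, so \<open>(y\<^sub>k)\<close> is a bounded sequence on which \<open>g\<close> is unbounded.\<close>

lemma bounded_functional_continuous: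
  fixes p :: "nat \<Rightarrow> 'a::complex_algebra \<Rightarrow> real" and g :: "'a \<Rightarrow> complex"
  assumes p: "\<And>l. seminorm (p l)" and inc: "\<And>l x. p l x \<le> p (Suc l) x"
    and g: "linear_on UNIV g"
    and bd: "\<And>S. bounded_subset (self_bimodule p) S \<Longrightarrow> bdd_above ((\<lambda>x. cmod (g x)) ` S)"
  shows "continuous_linear (self_bimodule p) scalar_bimodule g"
proof -
  have lc: "locally_convex (self_bimodule p)"
    using p by (auto simp: locally_convex_def seminorm_on_def seminorm_def complex_vector.subspace_UNIV)
  have "\<exists>k. \<forall>x. cmod (g x) \<le> real k * p k x"
  proof (rule ccontr)
    assume "\<nexists>k. \<forall>x. cmod (g x) \<le> real k * p k x"
    then have "\<forall>k. \<exists>x. real k * p k x < cmod (g x)" by (simp add: not_le)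
    then obtain x where x: "\<And>k. real k * p k (x k) < cmod (g (x k))" by metis
    have pos: "0 < cmod (g (x k))" for k
      using x[of k] seminormD(3)[OF p, of k "x k"] by (smt (verit) mult_nonneg_nonneg of_nat_0_le_iff)
    define y where "y k = (of_nat k / g (x k)) *\<^sub>C x k" for k
    have gy: "cmod (g (y k)) = real k" for k
      using pos[of k] linear_on_scale[OF g, of "x k"] by (simp add: y_def scaleC_complex_def)
    have py: "p k (y k) \<le> 1" for k
      using pos[of k] x[of k] by (simp add: y_def seminormD(2)[OF p] norm_divide field_simps)
    have mono: "p l z \<le> p k z" if "l \<le> k" for l k z
      using lift_Suc_mono_le[of "\<lambda>l. p l z", OF inc that] .
    have "bounded_subset (self_bimodule p) (range y)"
      unfolding bounded_subset_def
    proof (intro conjI ballI)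
      fix q assume "q \<in> seminorms (self_bimodule p)"
      then obtain l where q: "q = p l" by auto
      \<comment> \<open>From index \<open>l\<close> on,
        \<open>p l (y k) \<le> p k (y k) \<le> 1\<close> by monotonicity; the finitely many earlier
        terms do no harm.\<close>
      have "range y = y ` {..<l} \<union> y ` {l..}" by (auto simp: image_Un[symmetric] not_less)
      moreover have "bdd_above (p l ` y ` {..<l})" by (intro bdd_above_finite) auto
      moreover have "bdd_above (p l ` y ` {l..})"
        using order_trans[OF mono py] by (auto intro!: bdd_aboveI2[where M = 1])
      ultimately show "bdd_above (q ` range y)" by (simp add: q image_Un)
    qed simp
    from bd[OF this] obtain K where K: "\<And>k. real k \<le> K" by (auto simp: bdd_above_def gy)
    obtain k where "K < real k" using reals_Archimedean2 by blast
    with K[of k] show False by simp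
  qed
  then obtain k where "\<And>x. cmod (g x) \<le> real k * p k x" by blast
  then show ?thesis
    by (intro continuous_functional_scalarI[OF lc, of g "p k" "real k"]) (simp_all add: g)
qed

text \<open>This replaces the density of \<open>A\<^sup>2\<close>, tested only on the functional at hand:
  \<open>a \<mapsto> \<tau>(a)\<tau>\<close> is a derivation into the dual since \<open>\<tau>\<close> kills products, and an inner derivation
  satisfies \<open>D(a)(a) = 0\<close>.\<close>

lemma weakly_amenable_functional_eq_0:
  assumes M: "locally_convex_bimodule (self_bimodule p)" and B: "strong_dual (self_bimodule p) M' B"
    and wa: "\<And>D. continuous_derivation p M' D \<Longrightarrow> inner_derivation M' D"
    and \<tau>: "continuous_linear (self_bimodule p) scalar_bimodule \<tau>" and prod: "\<And>a b. \<tau> (a * b) = 0"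
  shows "\<tau> a = 0"
proof -
  note subM' = strong_dual_subspace[OF B]
  have M': "locally_convex M'" using B locally_convex_bimoduleD(1)[OF M] by (rule locally_convex_strong_dual)
  obtain f where f: "f \<in> carrier M'" "\<And>x. B f x = \<tau> x"
    using strong_dual_represent[OF B \<tau>] by auto
  have scale_mem: "z *\<^sub>C f \<in> carrier M'" for z using subM' f(1) by (rule complex_vector.subspace_scale)
  have scale: "B (z *\<^sub>C f) x = z * \<tau> x" for z x
    using linear_on_scale[OF strong_dual_linear[OF B] f(1)] f(2) by (simp add: scaleC_complex_def)
  have zero: "B 0 x = 0" for x
    using linear_on_zero[OF strong_dual_linear[OF B] complex_vector.subspace_0[OF subM']] by simp
  have "continuous_linear scalar_bimodule M' (\<lambda>z. z *\<^sub>C f)"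
  proof (rule continuous_linearI[OF locally_convex_scalar_bimodule M'])
    fix q assume "q \<in> seminorms M'"
    then have "q (z *\<^sub>C f) = cmod z * q f" for z
      using M' f(1) by (auto simp: locally_convex_def seminorm_on_def)
    then show "\<exists>t\<in>seminorms scalar_bimodule. \<exists>C. \<forall>z\<in>carrier scalar_bimodule. q (z *\<^sub>C f) \<le> C * t z"
      by (auto intro!: exI[of _ "q f"])
  qed (simp_all add: scale_mem linear_on_def scaleC_add_left scaleC_scaleC scaleC_complex_def)
  from continuous_linear_compose[OF \<tau> this]
  have "continuous_linear (self_bimodule p) M' (\<lambda>a. \<tau> a *\<^sub>C f)" .
  moreover have "lact M' b (z *\<^sub>C f) = 0" for b z
    by (rule strong_dual_eqI[OF B strong_dual_lact(1)[OF B scale_mem] complex_vector.subspace_0[OF subM']])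
      (simp add: strong_dual_lact(2)[OF B scale_mem] scale zero prod)
  moreover have "ract M' (z *\<^sub>C f) b = 0" for b z
    by (rule strong_dual_eqI[OF B strong_dual_ract(1)[OF B scale_mem] complex_vector.subspace_0[OF subM']])
      (simp add: strong_dual_ract(2)[OF B scale_mem] scale zero prod)
  ultimately have "continuous_derivation p M' (\<lambda>a. \<tau> a *\<^sub>C f)"
    by (simp add: continuous_derivation_iff prod complex_vector.scale_zero_left)
  from wa[OF this] obtain g where g: "g \<in> carrier M'" "\<And>a. \<tau> a *\<^sub>C f = lact M' a g - ract M' g a"
    by (auto simp: inner_derivation_def)
  have "\<tau> a * \<tau> a = B (lact M' a g - ract M' g a) a"
    using g(2)[of a] scale by metis
  also have "\<dots> = B (lact M' a g) a - B (ract M' g a) a"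
    by (rule linear_on_diff[OF strong_dual_linear[OF B] subM' strong_dual_lact(1)[OF B g(1)]
          strong_dual_ract(1)[OF B g(1)]]) simp
  also have "\<dots> = 0" using strong_dual_lact(2)[OF B g(1)] strong_dual_ract(2)[OF B g(1)] by simp
  finally show ?thesis by simp
qed

text \<open>\<open>R\<close> realizes \<open>f \<mapsto> Q f\<close> as a continuous bimodule map
  into the first dual, so \<open>R\<close> after \<open>D\<close> is a derivation there. If
  \<open>g\<close> implements it, then \<open>Q (D a) b = g(b a) - g(a b)\<close>, which changes
  sign when \<open>a\<close> and \<open>b\<close> are exchanged.\<close>

lemma weakly_amenable_pairing_alternating:
  assumes p: "frechet_algebra p" and B: "strong_dual (self_bimodule p) M' B"
    and wa: "\<And>D. continuous_derivation p M' D \<Longrightarrow> inner_derivation M' D"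
    and M: "locally_convex_bimodule M" and Q: "bounded_balanced_pairing p M Q"
    and D: "continuous_derivation p M D"
  shows "Q (D a) b + Q (D b) a = 0"
proof -
  have pl: "\<And>l. seminorm (p l)" "\<And>l x y. p l (x * y) \<le> p l x * p l y" "\<And>l x. p l x \<le> p (Suc l) x"
    using p by (simp_all add: frechet_algebra_def)
  have A: "locally_convex_bimodule (self_bimodule p)" using pl(1,2) by (rule self_bimodule_locally_convex)
  note lM = locally_convex_bimoduleD[OF M] and QD = bounded_balanced_pairingD[OF Q]
  note subM' = strong_dual_subspace[OF B]
  have M': "locally_convex M'" using B locally_convex_bimoduleD(1)[OF A] by (rule locally_convex_strong_dual)
  \<comment> \<open>The pairing controls \<open>Q f\<close> only on bounded sets, and representing
    \<open>Q f\<close> in the first dual requires continuity.\<close>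
  have "continuous_linear (self_bimodule p) scalar_bimodule (Q f)" if f: "f \<in> carrier M" for f
  proof (rule bounded_functional_continuous[of p, OF pl(1,3) QD(2)[OF f]])
    fix S assume "bounded_subset (self_bimodule p) S"
    then obtain q C where "\<And>a. a \<in> S \<Longrightarrow> cmod (Q f a) \<le> C * q f"
      using bounded_balanced_pairing_bound[OF Q] f by metis
    then show "bdd_above ((\<lambda>x. cmod (Q f x)) ` S)" by (rule bdd_aboveI2)
  qed
  then have "\<exists>g. g \<in> carrier M' \<and> (\<forall>x. B g x = Q f x)" if "f \<in> carrier M" for f
    using strong_dual_represent[OF B] that by (metis UNIV_I self_bimodule_simps(1))
  then obtain R where R: "\<And>f. f \<in> carrier M \<Longrightarrow> R f \<in> carrier M'"
      "\<And>f x. f \<in> carrier M \<Longrightarrow> B (R f) x = Q f x"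
    by metis
  have Rlin: "linear_on (carrier M) R"
  proof (rule strong_dual_linearI[OF B lM(2) R(1)])
    show "linear_on (carrier M) (\<lambda>f. B (R f) x)" for x
      using R(2)[symmetric] lM(2) QD(1) by (rule linear_on_cong)
  qed
  have "continuous_linear M M' R"
  proof (rule continuous_linearI[OF lM(1) M' Rlin R(1)])
    fix t assume "t \<in> seminorms M'"
    then obtain S where S: "bounded_subset (self_bimodule p) S" "S \<noteq> {}"
        "\<And>f. f \<in> carrier M' \<Longrightarrow> t f = (SUP x\<in>S. cmod (B f x))"
      by (rule strong_dual_seminorm[OF B]) blast
    obtain q C where q: "q \<in> seminorms M" "\<And>f a. f \<in> carrier M \<Longrightarrow> a \<in> S \<Longrightarrow> cmod (Q f a) \<le> C * q f"
      by (rule bounded_balanced_pairing_bound[OF Q S(1)]) blast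
    have "t (R f) \<le> C * q f" if f: "f \<in> carrier M" for f
      unfolding S(3)[OF R(1)[OF f]] by (rule cSUP_least[OF S(2)]) (simp add: R(2) f q(2))
    then show "\<exists>q\<in>seminorms M. \<exists>C. \<forall>f\<in>carrier M. t (R f) \<le> C * q f" using q(1) by blast
  qed
  have Dc: "continuous_linear (self_bimodule p) M D"
    and Dd: "\<And>a b. D (a * b) = lact M a (D b) + ract M (D a) b"
    using D by (simp_all add: continuous_derivation_iff)
  have Dm: "D a \<in> carrier M" for a using continuous_linear_mem[OF Dc] by simp
  have RL: "R (lact M a f) = lact M' a (R f)" if f: "f \<in> carrier M" for a f
    by (rule strong_dual_eqI[OF B R(1)[OF lM(5)[OF f]] strong_dual_lact(1)[OF B R(1)[OF f]]])
      (simp add: R(2) f lM(5) QD(3) strong_dual_lact(2)[OF B R(1)[OF f]])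
  have RR: "R (ract M f a) = ract M' (R f) a" if f: "f \<in> carrier M" for a f
    by (rule strong_dual_eqI[OF B R(1)[OF lM(6)[OF f]] strong_dual_ract(1)[OF B R(1)[OF f]]])
      (simp add: R(2) f lM(6) QD(4) strong_dual_ract(2)[OF B R(1)[OF f]])
  have "continuous_derivation p M' (\<lambda>a. R (D a))"
    using continuous_linear_compose[OF Dc \<open>continuous_linear M M' R\<close>]
    by (simp add: continuous_derivation_iff Dd linear_on_add[OF Rlin] lM(5,6) Dm RL RR)
  from wa[OF this] obtain g where g: "g \<in> carrier M'" "\<And>a. R (D a) = lact M' a g - ract M' g a"
    by (auto simp: inner_derivation_def)
  have "Q (D x) y = B g (y * x) - B g (x * y)" for x y
  proof -
    have "Q (D x) y = B (lact M' x g - ract M' g x) y" using R(2)[OF Dm] g(2) by metis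
    also have "\<dots> = B (lact M' x g) y - B (ract M' g x) y"
      by (rule linear_on_diff[OF strong_dual_linear[OF B] subM' strong_dual_lact(1)[OF B g(1)]
            strong_dual_ract(1)[OF B g(1)]]) simp
    finally show ?thesis using strong_dual_lact(2)[OF B g(1)] strong_dual_ract(2)[OF B g(1)] by simp
  qed
  then show ?thesis by simp
qed

section \<open>Comparison of the derivations of the algebra and of its unitization\<close>

lemma unitization_amenable_iff:
  assumes p: "frechet_algebra p" and B: "strong_dual (self_bimodule p) M' B"
    and wa: "\<And>D. continuous_derivation p M' D \<Longrightarrow> inner_derivation M' D"
    and lev: "unitization_level p M N r s \<sigma> E P Q" and P0: "\<And>a. P a = 0"
  shows "(\<forall>D. continuous_derivation (unitization_seminorms p) N D \<longrightarrow> inner_derivation N D) \<longleftrightarrow>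
    (\<forall>D. continuous_derivation p M D \<longrightarrow> inner_derivation M D)"
proof -
  let ?A = "self_bimodule p" and ?U = "self_bimodule (unitization_seminorms p)"
  have pl: "\<And>l. seminorm (p l)" "\<And>l x y. p l (x * y) \<le> p l x * p l y"
    using p by (simp_all add: frechet_algebra_def)
  have M: "locally_convex_bimodule M" and N: "locally_convex_bimodule N"
    and sp: "unitization_split M N r s \<sigma> E" and act: "unitization_action M N r \<sigma> P Q"
    and Q: "bounded_balanced_pairing p M Q"
    using lev by (simp_all add: unitization_level_def)
  have base: "unitization_split ?A ?U alg_part (\<lambda>a. Unitization a 0) scalar_part (Unitization 0 1)"
    and A: "locally_convex_bimodule ?A"
    using unitization_level_self[of p, OF pl] by (simp_all add: unitization_level_def)
  note lM = locally_convex_bimoduleD[OF M] and lN = locally_convex_bimoduleD[OF N]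
  note spD = unitization_splitD[OF sp] and bD = unitization_splitD[OF base]
  \<comment> \<open>With \<open>P = 0\<close> the term
    \<open>\<sigma> y *\<^sub>C P (alg_part u)\<close> disappears, so \<open>r\<close> commutes with
    the actions of the algebra; this lets derivations be projected from \<open>N\<close> to
    \<open>M\<close>.\<close>
  note actD = unitization_actionD[OF act, unfolded P0 complex_vector.scale_zero_right add_0_right]
  note QD = bounded_balanced_pairingD[OF Q]
  note rlin = continuous_linear_linear[OF spD(1)] and slin = continuous_linear_linear[OF spD(2)]
    and \<sigma>lin = continuous_linear_linear[OF spD(3)]
  show ?thesis
  proof (intro iffI allI impI)
    fix D assume U: "\<forall>D. continuous_derivation (unitization_seminorms p) N D \<longrightarrow> inner_derivation N D"
      and D: "continuous_derivation p M D"
    have Dc: "continuous_linear ?A M D"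
      and Dd: "\<And>a b. D (a * b) = lact M a (D b) + ract M (D a) b"
      using D by (simp_all add: continuous_derivation_iff)
    have Dm: "D a \<in> carrier M" for a using continuous_linear_mem[OF Dc] by simp
    note Dlin = continuous_linear_linear[OF Dc]
    have alt: "Q (D a) b + Q (D b) a = 0" for a b
      by (rule weakly_amenable_pairing_alternating[OF p B wa M Q D])
    \<comment> \<open>The lift ignores the scalar part and has no \<open>E\<close>-component. In the
      coordinate \<open>r\<close> this is the derivation law of \<open>D\<close>; in the coordinate
      \<open>\<sigma>\<close> the left side is \<open>0\<close>, and the right side is the sum that
      vanishes by \<open>alt\<close>.\<close>
    have "s (D (alg_part (u * v))) = lact N u (s (D (alg_part v))) + ract N (s (D (alg_part u))) v" for u v
    proof (rule unitization_split_eqI[OF sp])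
      have mem: "lact N u (s (D (alg_part v))) \<in> carrier N" "ract N (s (D (alg_part u))) v \<in> carrier N"
        by (simp_all add: lN(5,6) spD Dm)
      then show "lact N u (s (D (alg_part v))) + ract N (s (D (alg_part u))) v \<in> carrier N"
        by (rule complex_vector.subspace_add[OF lN(2)])
      have "D (alg_part (u * v)) = D (alg_part u * alg_part v) + scalar_part v *\<^sub>C D (alg_part u)
          + scalar_part u *\<^sub>C D (alg_part v)"
        using linear_on_add[OF Dlin] linear_on_scale[OF Dlin] by simp
      then show "r (s (D (alg_part (u * v)))) =
          r (lact N u (s (D (alg_part v))) + ract N (s (D (alg_part u))) v)"
        unfolding spD(7)[OF Dm] using linear_on_add[OF rlin mem]
        by (simp del: unitization_simps add: actD spD Dm Dd add_ac)
      show "\<sigma> (s (D (alg_part (u * v)))) =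
          \<sigma> (lact N u (s (D (alg_part v))) + ract N (s (D (alg_part u))) v)"
        using linear_on_add[OF \<sigma>lin mem] alt[of "alg_part v" "alg_part u"]
        by (simp del: unitization_simps add: actD spD Dm)
    qed (simp add: spD Dm)
    then have "continuous_derivation (unitization_seminorms p) N (\<lambda>u. s (D (alg_part u)))"
      using continuous_linear_compose[OF continuous_linear_compose[OF bD(1) Dc] spD(2)]
      unfolding continuous_derivation_iff by blast
    with U obtain y where y: "y \<in> carrier N" "\<And>u. s (D (alg_part u)) = lact N u y - ract N y u"
      unfolding inner_derivation_def by blast
    have "D a = lact M a (r y) - ract M (r y) a" for a
    proof -
      have "D a = r (s (D (alg_part (Unitization a 0))))" by (simp add: spD Dm)
      also have "\<dots> = r (lact N (Unitization a 0) y) - r (ract N y (Unitization a 0))"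
        unfolding y(2) by (rule linear_on_diff[OF rlin lN(2) lN(5)[OF y(1)] lN(6)[OF y(1)]])
      finally show ?thesis by (simp add: actD y(1) complex_vector.scale_zero_left)
    qed
    then show "inner_derivation M D"
      unfolding inner_derivation_def using spD(11)[OF y(1)] by blast
  next
    fix D assume Am: "\<forall>D. continuous_derivation p M D \<longrightarrow> inner_derivation M D"
      and D: "continuous_derivation (unitization_seminorms p) N D"
    have Dc: "continuous_linear ?U N D"
      and Dd: "\<And>u v. D (u * v) = lact N u (D v) + ract N (D u) v"
      using D by (simp_all add: continuous_derivation_iff)
    have Dm: "D u \<in> carrier N" for u using continuous_linear_mem[OF Dc] by simp
    note Dlin = continuous_linear_linear[OF Dc]
    note mem = lN(5)[OF Dm] lN(6)[OF Dm]
    define d where "d a = r (D (Unitization a 0))" for a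
    define \<tau> where "\<tau> a = \<sigma> (D (Unitization a 0))" for a
    have dm: "d a \<in> carrier M" for a by (simp add: d_def spD Dm)
    have prod: "Unitization (a * b) 0 = Unitization a 0 * Unitization b 0" for a b :: 'a
      by (rule unitization.expand) (simp add: complex_vector.scale_zero_left)
    have "continuous_derivation p M d"
      unfolding continuous_derivation_iff
    proof (intro conjI allI)
      show "continuous_linear ?A M d"
        unfolding d_def by (rule continuous_linear_compose[OF continuous_linear_compose[OF bD(2) Dc] spD(1)])
      show "d (a * b) = lact M a (d b) + ract M (d a) b" for a b
        using linear_on_add[OF rlin mem]
        by (simp add: d_def prod Dd actD Dm complex_vector.scale_zero_left)
    qed
    with Am obtain x where x: "x \<in> carrier M" "\<And>a. d a = lact M a x - ract M x a"
      unfolding inner_derivation_def by blast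
    have Qd: "Q (d a) b = Q x (b * a) - Q x (a * b)" for a b
      using linear_on_diff[OF QD(1) lM(2) lM(5)[OF x(1)] lM(6)[OF x(1)]]
      by (simp add: x(2) QD(3,4) x(1))
    \<comment> \<open>The derivation law of \<open>D\<close> in the coordinate
      \<open>\<sigma>\<close> gives \<open>\<tau> (a * b) = Q (d b) a + Q (d a) b\<close>, and the
      two terms cancel by \<open>Qd\<close>.\<close>
    have "\<tau> (a * b) = 0" for a b
      using linear_on_add[OF \<sigma>lin mem] Qd[of a b] Qd[of b a]
      by (simp add: \<tau>_def prod Dd actD Dm d_def)
    moreover have "continuous_linear ?A scalar_bimodule \<tau>"
      unfolding \<tau>_def by (rule continuous_linear_compose[OF continuous_linear_compose[OF bD(2) Dc] spD(3)])
    ultimately have \<tau>0: "\<tau> a = 0" for a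
      using weakly_amenable_functional_eq_0[OF A B wa] by blast
    have zero: "lact M 0 z = 0" "ract M z 0 = 0" "Q z 0 = 0" if "z \<in> carrier M" for z
      using linear_on_zero[OF lM(7)[OF that]] linear_on_zero[OF lM(8)[OF that]]
        linear_on_zero[OF QD(2)[OF that]] by simp_all
    let ?e = "Unitization 0 1 :: 'a unitization"
    have e: "lact N ?e y = y" "ract N y ?e = y" if y: "y \<in> carrier N" for y
      by (rule unitization_split_eqI[OF sp]; simp add: lN(5,6) y actD zero spD scaleC_one)+
    have "?e * ?e = ?e" by (rule unitization.expand) (simp add: complex_vector.scale_zero_right)
    \<comment> \<open>As \<open>?e\<close> acts as the identity on \<open>N\<close>, the derivation
      law reads \<open>D ?e = D ?e + D ?e\<close>.\<close>
    then have De: "D ?e = 0" using Dd[of ?e ?e] by (simp add: e Dm)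
    \<comment> \<open>The implementing element of \<open>d\<close> is lifted by \<open>s\<close>.
      The coordinates \<open>r\<close> agree by the choice of \<open>x\<close>, and both
      \<open>\<sigma>\<close> coordinates are \<open>0\<close>: on the left by
      \<open>\<tau>0\<close>, on the right because the two evaluation terms cancel.\<close>
    have "D u = lact N u (s x) - ract N (s x) u" for u
    proof (rule unitization_split_eqI[OF sp Dm])
      have sx: "s x \<in> carrier N" by (rule spD(10)[OF x(1)])
      have mem: "lact N u (s x) \<in> carrier N" "ract N (s x) u \<in> carrier N"
        using lN(5,6) sx by auto
      then show "lact N u (s x) - ract N (s x) u \<in> carrier N"
        by (rule complex_vector.subspace_diff[OF lN(2)])
      have "u = Unitization (alg_part u) 0 + scalar_part u *\<^sub>C ?e"
        by (rule unitization.expand) (simp add: complex_vector.scale_zero_right)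
      then have Du: "D u = D (Unitization (alg_part u) 0)"
        using linear_on_add[OF Dlin] linear_on_scale[OF Dlin] De
        by (metis UNIV_I add.right_neutral complex_vector.scale_zero_right self_bimodule_simps(1))
      show "r (D u) = r (lact N u (s x) - ract N (s x) u)"
        using linear_on_diff[OF rlin lN(2) mem] x(2)[of "alg_part u"]
        by (simp add: Du d_def[symmetric] actD sx spD x(1))
      show "\<sigma> (D u) = \<sigma> (lact N u (s x) - ract N (s x) u)"
        using linear_on_diff[OF \<sigma>lin lN(2) mem] \<tau>0[of "alg_part u"]
        by (simp add: Du \<tau>_def[symmetric] actD sx spD x(1))
    qed
    then show "inner_derivation N D"
      unfolding inner_derivation_def using spD(10)[OF x(1)] by blast
  qed
qed

theorem corollary3p19:
  fixes p :: "nat \<Rightarrow> 'a::complex_algebra \<Rightarrow> real"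
    and i :: "'a \<Rightarrow> 'u::complex_vector"
    and c :: "nat \<Rightarrow> ('u \<Rightarrow> complex) \<Rightarrow> 'u"
    and j :: "'a unitization \<Rightarrow> 'v::complex_vector"
    and d :: "nat \<Rightarrow> ('v \<Rightarrow> complex) \<Rightarrow> 'v"
    and n :: nat
  assumes "frechet_algebra p"
    and "n \<ge> 1"
    and "dual_universe i c (2 * n + 1)"
    and "dual_universe j d (2 * n + 1)"
    and "n_weakly_amenable i c 1 p"
  shows "n_weakly_amenable j d (2 * n + 1) (unitization_seminorms p) \<longleftrightarrow>
         n_weakly_amenable i c (2 * n + 1) p"
proof -
  have pl: "\<And>l. seminorm (p l)" "\<And>l x y. p l (x * y) \<le> p l x * p l y"
    using assms(1) by (simp_all add: frechet_algebra_def)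
  obtain B where B: "strong_dual (self_bimodule p) (iterated_dual i c (self_bimodule p) 1) B"
    by (rule first_dual_strong_dual[OF assms(3) self_bimodule_locally_convex[OF pl]]) simp_all
  have wa: "\<And>D. continuous_derivation p (iterated_dual i c (self_bimodule p) 1) D \<Longrightarrow>
      inner_derivation (iterated_dual i c (self_bimodule p) 1) D"
    using assms(5) unfolding n_weakly_amenable_def by blast
  \<comment> \<open>The level \<open>2 * n + 1\<close> has the even index \<open>2 * n\<close> in
    \<open>unitization_level_iterated\<close>, hence \<open>P = 0\<close>.\<close>
  obtain r s \<sigma> E P Q where "unitization_level p (iterated_dual i c (self_bimodule p) (2 * n + 1))
      (iterated_dual j d (self_bimodule (unitization_seminorms p)) (2 * n + 1)) r s \<sigma> E P Q"
      "\<And>a. P a = 0"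
    using unitization_level_iterated[of p, OF pl assms(3,4), of "2 * n"]
    by (auto simp del: iterated_dual.simps)
  from unitization_amenable_iff[OF assms(1) B wa this] show ?thesis
    unfolding n_weakly_amenable_def .
qed

end
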